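(* Let $n\ge 7$ and let $M=(m_{ij})_{i,j=1}^n$ be an $n\times n$ array where each cell is colored red or blue. Then $M$ can be partitioned into $n$ balanced diagonals if and only if for each of the two colors there is a proper set of $n$ cells all colored with that color.
   Context: A diagonal of an $n\times n$ array is a set of $n$ cells no two of which lie in the same row or the same column. A diagonal in a 2-colored array is balanced if it contains at least one cell of each color. A set $A$ of cells of an $n\times n$ array is improper if there exist $i,j\in\{1,\dots,n\}$ such that every cell of $A$ lies either in row $i$ or in column $j$ but not in both (i.e., $A$ is contained in the union of row $i$ and column $j$ and does not contain the cell $(i,j)$); otherwise $A$ is proper. *)

theory Defs
  imports Main "HOL-Library.Disjoint_Sets"
begin

datatype color = Red | Blue

text \<open>
  A cell is a pair (row, column). A 2-colored array is a function
  \<open>M :: nat \<times> nat \<Rightarrow> color\<close>, of which only the values on \<open>cells n\<close> are relevant.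
\<close>

definition cells :: "nat \<Rightarrow> (nat \<times> nat) set" where
  "cells n = {1..n} \<times> {1..n}"

definition diagonal :: "nat \<Rightarrow> (nat \<times> nat) set \<Rightarrow> bool" where
  "diagonal n D \<longleftrightarrow> D \<subseteq> cells n \<and> card D = n \<and>
     (\<forall>c\<in>D. \<forall>d\<in>D. c \<noteq> d \<longrightarrow> fst c \<noteq> fst d \<and> snd c \<noteq> snd d)"

definition balanced :: "(nat \<times> nat \<Rightarrow> color) \<Rightarrow> (nat \<times> nat) set \<Rightarrow> bool" where
  "balanced M D \<longleftrightarrow> (\<forall>k. \<exists>c\<in>D. M c = k)"

text \<open>
  The inequality of truth values below is the exclusive or: the cell lies in row \<open>i\<close>
  or in column \<open>j\<close> but not in both.
\<close>

definition improper :: "nat \<Rightarrow> (nat \<times> nat) set \<Rightarrow> bool" where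
  "improper n A \<longleftrightarrow>
     (\<exists>i\<in>{1..n}. \<exists>j\<in>{1..n}. \<forall>c\<in>A. (fst c = i) \<noteq> (snd c = j))"

abbreviation proper :: "nat \<Rightarrow> (nat \<times> nat) set \<Rightarrow> bool" where
  "proper n A \<equiv> \<not> improper n A"

end

theory Submission
  imports Defs "HOL-Number_Theory.Cong"
begin

text \<open>
  A partition of the array into diagonals is a Latin square, the diagonals being its symbol
  classes. First, a proper set \<open>A\<close> of \<open>n\<close> cells carries \<open>n\<close> different symbols in some Latin
  square. This is shown by induction on \<open>n\<close>: if some cell of \<open>A\<close> shares a row or a column with
  another one, then rows and columns can be ordered so that this cell lies on the antidiagonal and
  the rest of \<open>A\<close> above it, and Smetaniuk's construction extends a Latin square of order \<open>n - 1\<close>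
  without changing it above the antidiagonal. The cell can be chosen such that the rest of \<open>A\<close>
  is again proper, unless \<open>n = 4\<close> and \<open>A\<close> consists of two cells in each of two rows (or columns).
  If there is no such cell, \<open>A\<close> has to be made a transversal.

  Now let \<open>A\<close> be a proper set of \<open>n\<close> cells of color \<open>k\<close>. If at most \<open>2 * n - 2\<close> cells have color
  \<open>k\<close>, no diagonal meeting \<open>A\<close> only once can be monochromatic. The same holds if \<open>A\<close> contains all
  cells of color \<open>k\<close> in two rows, because each diagonal has a cell in both of these rows. When both
  colors occur at least \<open>2 * n - 1\<close> times, such an \<open>A\<close> exists for one of them: among four rows,
  there are two with at most one cell of color \<open>k\<close> each, or two with at least two cells of each
  color, and these two rows have at most \<open>n\<close> cells of one of the colors.
\<close>

section \<open>Latin squares\<close>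

text \<open>Rows, columns and symbols form arbitrary sets, so that the inductions can delete and
  reorder lines without renaming them. Values of \<open>L\<close> outside
  \<open>R \<times> C\<close> are unconstrained.\<close>

definition latin :: "'a set \<Rightarrow> 'b set \<Rightarrow> 'c set \<Rightarrow> ('a \<Rightarrow> 'b \<Rightarrow> 'c) \<Rightarrow> bool" where
  "latin R C S L \<longleftrightarrow> (\<forall>i\<in>R. bij_betw (L i) C S) \<and> (\<forall>j\<in>C. bij_betw (\<lambda>i. L i j) R S)"

definition rainbow :: "('a \<Rightarrow> 'b \<Rightarrow> 'c) \<Rightarrow> ('a \<times> 'b) set \<Rightarrow> bool" where
  "rainbow L A \<longleftrightarrow> inj_on (\<lambda>(i, j). L i j) A"

lemma rainbowI:
  assumes "\<And>i j i' j'. \<lbrakk>(i, j) \<in> A; (i', j') \<in> A; L i j = L i' j'\<rbrakk> \<Longrightarrow> i = i' \<and> j = j'"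
  shows "rainbow L A"
  unfolding rainbow_def inj_on_def using assms by (auto split: prod.splits)

lemma surj_imp_bij_betw:
  assumes "finite B" "card A = card B" "f ` A = B" "finite A"
  shows "bij_betw f A B"
  using assms by (simp add: bij_betw_def eq_card_imp_inj_on)

lemma inj_imp_bij_betw:
  assumes "finite B" "card A = card B" "inj_on f A" "f ` A \<subseteq> B"
  shows "bij_betw f A B"
  using assms by (simp add: bij_betw_def card_image card_subset_eq)

lemma latin_transport:
  assumes L: "latin R' C' S L" and \<rho>: "bij_betw \<rho> R R'" and \<gamma>: "bij_betw \<gamma> C C'"
  shows "latin R C S (\<lambda>i j. L (\<rho> i) (\<gamma> j))"
  unfolding latin_def
proof (intro conjI ballI)
  fix i assume "i \<in> R"
  then have "bij_betw (L (\<rho> i)) C' S"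
    using L \<rho> bij_betwE unfolding latin_def by blast
  from bij_betw_trans[OF \<gamma> this] show "bij_betw (\<lambda>j. L (\<rho> i) (\<gamma> j)) C S"
    by (simp add: comp_def)
next
  fix j assume "j \<in> C"
  then have "bij_betw (\<lambda>i. L i (\<gamma> j)) R' S"
    using L \<gamma> bij_betwE unfolding latin_def by blast
  from bij_betw_trans[OF \<rho> this] show "bij_betw (\<lambda>i. L (\<rho> i) (\<gamma> j)) R S"
    by (simp add: comp_def)
qed

section \<open>Smetaniuk's extension of a Latin square by one symbol\<close>

text \<open>Follow the chain \<open>j0\<close>, \<open>j1\<close>, \<open>j2\<close>, ... with
  \<open>w j0 = z j1\<close>, \<open>w j1 = z j2\<close> and so on. Injectivity keeps it from
  closing up, so by finiteness it stops at some \<open>t\<close> for which \<open>w t\<close> is not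
  a value of \<open>z\<close> on \<open>J\<close>. The indices after \<open>j0\<close> form
  \<open>J'\<close>.\<close>

lemma exchange_chain:
  assumes "finite J" "j0 \<notin> J" "inj_on z J" "inj_on w (insert j0 J)"
  shows "\<exists>J' t. J' \<subseteq> J \<and> t \<in> insert j0 J' \<and> w ` insert j0 J' = insert (w t) (z ` J') \<and> w t \<notin> z ` J"
  using assms
proof (induction "card J" arbitrary: J j0)
  case 0
  then show ?case by auto
next
  case (Suc k)
  show ?case
  proof (cases "w j0 \<in> z ` J")
    case False
    then show ?thesis by (intro exI[of _ "{}"] exI[of _ j0]) auto
  next
    case True
    then obtain j1 where j1: "j1 \<in> J" "w j0 = z j1" by auto
    have "\<exists>J' t. J' \<subseteq> J - {j1} \<and> t \<in> insert j1 J' \<and> w ` insert j1 J' = insert (w t) (z ` J')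
        \<and> w t \<notin> z ` (J - {j1})"
    proof (rule Suc.hyps(1))
      show "k = card (J - {j1})" using Suc.hyps(2) Suc.prems(1) j1 by simp
      show "inj_on z (J - {j1})" using Suc.prems(3) by (rule inj_on_subset) auto
      show "inj_on w (insert j1 (J - {j1}))" using Suc.prems(4) by (rule inj_on_subset) (use j1 in auto)
    qed (use Suc.prems in auto)
    then obtain J' t where J': "J' \<subseteq> J - {j1}" "t \<in> insert j1 J'"
      "w ` insert j1 J' = insert (w t) (z ` J')" "w t \<notin> z ` (J - {j1})" by blast
    have "t \<in> J" "t \<noteq> j0" using J' j1 Suc.prems(2) by auto
    then have "w t \<noteq> w j0" using Suc.prems(4) unfolding inj_on_def by blast
    then have "w t \<notin> z ` J" using J'(4) j1 by auto
    moreover have "w ` insert j0 (insert j1 J') = insert (w t) (z ` insert j1 J')"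
      using J'(3) j1(2) by auto
    moreover have "insert j1 J' \<subseteq> J" "t \<in> insert j0 (insert j1 J')" using J' j1 by auto
    ultimately show ?thesis by blast
  qed
qed

text \<open>
  The rows are rebuilt one at a time. In a column \<open>j\<close> that has already received the new symbol
  \<open>m\<close>, the symbol \<open>z j\<close> is the one that this has displaced; the displaced symbols are collected in
  the new last column, where they have to stay distinct.
\<close>

definition rebuilt_rows where
  "rebuilt_rows m L k K z \<longleftrightarrow>
    (\<forall>i<k. K i ` {..m} = {..m}) \<and>
    (\<forall>i<k. \<forall>j. (i + j < m \<longrightarrow> K i j = L i j) \<and> (i + j = m \<longrightarrow> K i j = m)) \<and>
    (\<forall>j\<in>{Suc m - k..<m}. z j \<in> (\<lambda>i. L i j) ` {..<k} \<and>
      (\<lambda>i. K i j) ` {..<k} = insert m ((\<lambda>i. L i j) ` {..<k} - {z j})) \<and>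
    (\<lambda>i. K i m) ` {..<k} = insert m (z ` {Suc m - k..<m}) \<and> inj_on z {Suc m - k..<m}" for m k :: nat

text \<open>Row \<open>k\<close> is copied from \<open>L\<close>, with \<open>m\<close> written into
  column \<open>m - k\<close>. The symbol displaced there should move to the last column, but may
  already occur in it. An exchange chain repairs this: in the later columns of the chain the old
  displaced symbol \<open>z j\<close> returns and \<open>w j\<close> is displaced instead, until
  some \<open>w t\<close> is new to the last column.\<close>

lemma smetaniuk_rows:
  assumes L: "latin {..<m} {..<m} {..<m} (L :: nat \<Rightarrow> nat \<Rightarrow> nat)" and "Suc 0 \<le> k" "k \<le> m"
  shows "\<exists>K z. rebuilt_rows m L k K z"
  using assms(2,3)
proof (induction k rule: dec_induct)
  \<comment> \<open>For \<open>k = 1\<close> the range \<open>{Suc m - k..<m}\<close> is empty: row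
    0 merely gains \<open>m\<close> in the last column, and no symbol has been displaced
    yet.\<close>
  case base
  have "L 0 ` {..<m} = {..<m}" using L base unfolding latin_def bij_betw_def by auto
  moreover have "(\<lambda>j. if j < m then L 0 j else m) ` {..m} = insert m (L 0 ` {..<m})"
    by (auto simp flip: lessThan_Suc_atMost simp: lessThan_Suc)
  ultimately have "(\<lambda>j. if j < m then L 0 j else m) ` {..m} = {..m}" by auto
  then show ?case
    unfolding rebuilt_rows_def by (intro exI[of _ "\<lambda>i j. if j < m then L 0 j else m"]) auto
next
  case (step k)
  then have k: "Suc 0 \<le> k" "k < m" by auto
  define j0 where "j0 = m - k"
  define J where "J = {Suc m - k..<m}"
  define w where "w = L k"
  obtain K z where inv: "rebuilt_rows m L k K z" using step.IH k by auto
  then have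
    rows: "\<And>i. i < k \<Longrightarrow> K i ` {..m} = {..m}" and
    kept: "\<And>i j. i < k \<Longrightarrow> i + j < m \<Longrightarrow> K i j = L i j" "\<And>i j. i < k \<Longrightarrow> i + j = m \<Longrightarrow> K i j = m" and
    z: "\<And>j. j \<in> J \<Longrightarrow> z j \<in> (\<lambda>i. L i j) ` {..<k}" and
    cols: "\<And>j. j \<in> J \<Longrightarrow> (\<lambda>i. K i j) ` {..<k} = insert m ((\<lambda>i. L i j) ` {..<k} - {z j})" and
    last: "(\<lambda>i. K i m) ` {..<k} = insert m (z ` J)" and inj: "inj_on z J"
    unfolding rebuilt_rows_def J_def by auto
  have j0: "j0 < m" "j0 \<notin> J" and J': "{Suc m - Suc k..<m} = insert j0 J" and Jm: "\<And>j. j \<in> J \<Longrightarrow> j < m"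
    using k unfolding j0_def J_def by auto
  have wim: "w ` {..<m} = {..<m}" and winj: "inj_on w {..<m}"
    using L k unfolding latin_def bij_betw_def w_def by auto
  have new: "w j \<notin> (\<lambda>i. L i j) ` {..<k}" if "j < m" for j
  proof -
    have "inj_on (\<lambda>i. L i j) {..<m}" using L that unfolding latin_def bij_betw_def by auto
    then show ?thesis using k unfolding w_def inj_on_def by force
  qed
  have "\<exists>I t. I \<subseteq> J \<and> t \<in> insert j0 I \<and> w ` insert j0 I = insert (w t) (z ` I) \<and> w t \<notin> z ` J"
  proof (rule exchange_chain[OF _ j0(2) inj])
    show "inj_on w (insert j0 J)" by (rule inj_on_subset[OF winj]) (use j0 Jm in auto)
  qed (simp add: J_def)
  then obtain I t where I: "I \<subseteq> J" "t \<in> insert j0 I" "w ` insert j0 I = insert (w t) (z ` I)" "w t \<notin> z ` J"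
    by blast
  define new_row where "new_row = (\<lambda>j. if j = j0 then m else if j = m then w t else if j \<in> I then z j else w j)"
  define K' where "K' = K(k := new_row)"
  define z' where "z' = (\<lambda>j. if j \<in> insert j0 I then w j else z j)"
  have K'old: "\<And>i. i < k \<Longrightarrow> K' i = K i" and K'new: "K' k = new_row" unfolding K'_def by auto
  have imK': "(\<lambda>i. K' i j) ` {..<Suc k} = insert (new_row j) ((\<lambda>i. K i j) ` {..<k})" for j
    by (auto simp: lessThan_Suc K'new K'old)
  have imL: "(\<lambda>i. L i j) ` {..<Suc k} = insert (w j) ((\<lambda>i. L i j) ` {..<k})" for j
    by (auto simp: lessThan_Suc w_def)
  have IJm: "insert j0 I \<subseteq> {..<m}" using I(1) Jm j0(1) by auto
  have Im: "m \<notin> I" "j0 \<notin> I" using I(1) Jm j0 by auto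
  \<comment> \<open>The chain trades the symbols of \<open>w\<close> on \<open>insert j0 I\<close>
    for \<open>w t\<close> and the symbols of \<open>z\<close> on \<open>I\<close>, which is the
    same set; so the row only gains \<open>m\<close>.\<close>
  have row: "new_row ` {..m} = {..m}"
  proof -
    have e: "{..m} = insert j0 (insert m (I \<union> ({..<m} - insert j0 I)))"
      using IJm j0(1) by (auto simp: less_imp_le subset_iff)
    have "new_row ` {..m} = insert m (insert (w t) (z ` I)) \<union> w ` ({..<m} - insert j0 I)"
      unfolding e using j0 Im by (auto simp: new_row_def image_iff)
    also have "\<dots> = insert m (w ` (insert j0 I \<union> ({..<m} - insert j0 I)))"
      unfolding I(3)[symmetric] by auto
    also have "insert j0 I \<union> ({..<m} - insert j0 I) = {..<m}" using I j0 Jm by auto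
    finally show ?thesis using wim by auto
  qed
  \<comment> \<open>The displaced symbols are the old ones and the single new symbol
    \<open>w t\<close>. Counting then shows that they remain distinct.\<close>
  have z'im: "z' ` insert j0 J = insert (w t) (z ` J)"
  proof -
    have "insert j0 J = insert j0 I \<union> (J - I)" using I by auto
    then have "z' ` insert j0 J = z' ` insert j0 I \<union> z' ` (J - I)" by (simp only: image_Un)
    also have "z' ` insert j0 I = w ` insert j0 I" unfolding z'_def by auto
    also have "\<dots> = insert (w t) (z ` I)" by (rule I(3))
    also have "z' ` (J - I) = z ` (J - I)" unfolding z'_def using j0 by auto
    also have "insert (w t) (z ` I) \<union> z ` (J - I) = insert (w t) (z ` J)" using I(1) by blast
    finally show ?thesis .
  qed
  have z'inj: "inj_on z' (insert j0 J)"
  proof (rule eq_card_imp_inj_on)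
    show "finite (insert j0 J)" unfolding J_def by simp
    then show "card (z' ` insert j0 J) = card (insert j0 J)"
      unfolding z'im using I(4) j0(2) inj by (simp add: card_image)
  qed
  show ?case
    unfolding rebuilt_rows_def
  proof (intro exI[of _ K'] exI[of _ z'] conjI allI ballI impI)
    show "K' i ` {..m} = {..m}" if "i < Suc k" for i
      using that rows row K'old K'new by (cases "i = k") auto
    show "K' i j = L i j" if "i < Suc k" "i + j < m" for i j
    proof (cases "i = k")
      case True
      then have "j < j0" "j \<notin> I" "j \<noteq> m" using that I k unfolding j0_def J_def by auto
      then show ?thesis using True K'new unfolding new_row_def w_def by simp
    qed (use that kept K'old in auto)
    show "K' i j = m" if "i < Suc k" "i + j = m" for i j
    proof (cases "i = k")
      case True
      then have "j = j0" using that unfolding j0_def by auto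
      then show ?thesis using True K'new unfolding new_row_def by simp
    qed (use that kept K'old in auto)
    show "inj_on z' {Suc m - Suc k..<m}" unfolding J' by (rule z'inj)
    show "(\<lambda>i. K' i m) ` {..<Suc k} = insert m (z' ` {Suc m - Suc k..<m})"
      unfolding imK' J' z'im last using j0 by (auto simp: new_row_def)
  next
    fix j assume "j \<in> {Suc m - Suc k..<m}"
    then have jJ: "j \<in> insert j0 J" by (simp only: J')
    then have jm: "j < m" using j0 Jm by auto
    note nw = new[OF jm]
    consider "j = j0" | "j \<in> I" "j \<noteq> j0" | "j \<in> J" "j \<notin> I" "j \<noteq> j0" using jJ by blast
    then have "z' j \<in> (\<lambda>i. L i j) ` {..<Suc k} \<and>
      (\<lambda>i. K' i j) ` {..<Suc k} = insert m ((\<lambda>i. L i j) ` {..<Suc k} - {z' j})"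
    proof cases
      case 1
      have "(\<lambda>i. K i j) ` {..<k} = (\<lambda>i. L i j) ` {..<k}"
        using kept(1) k unfolding 1 j0_def by (intro image_cong) auto
      then show ?thesis unfolding imK' imL using nw 1 by (auto simp: new_row_def z'_def)
    next
      case 2
      then have "j \<in> J" using I by auto
      then show ?thesis unfolding imK' imL using nw 2 cols z jm by (auto simp: new_row_def z'_def)
    next
      case 3
      then show ?thesis unfolding imK' imL using nw cols z jm by (auto simp: new_row_def z'_def)
    qed
    then show "z' j \<in> (\<lambda>i. L i j) ` {..<Suc k}"
      "(\<lambda>i. K' i j) ` {..<Suc k} = insert m ((\<lambda>i. L i j) ` {..<Suc k} - {z' j})" by auto
  qed
qed

text \<open>After the first \<open>m\<close> rows each column lacks exactly one symbol:
  \<open>m\<close> in column 0, \<open>z j\<close> in a column \<open>j\<close> strictly between 0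
  and \<open>m\<close>, and some \<open>x\<close> in the last column. These symbols are distinct and
  form the final row.\<close>

lemma smetaniuk:
  assumes L: "latin {..<m} {..<m} {..<m} (L :: nat \<Rightarrow> nat \<Rightarrow> nat)"
  shows "\<exists>K. latin {..m} {..m} {..m} K \<and>
    (\<forall>i\<le>m. \<forall>j\<le>m. (i + j < m \<longrightarrow> K i j = L i j) \<and> (i + j = m \<longrightarrow> K i j = m))"
proof (cases "m = 0")
  case True
  then show ?thesis by (intro exI[of _ "\<lambda>_ _. 0"]) (auto simp: latin_def bij_betw_def)
next
  case False
  then have m: "Suc 0 \<le> m" by simp
  obtain K z where inv: "rebuilt_rows m L m K z" using smetaniuk_rows[OF L m order_refl] by auto
  then have
    rows: "\<And>i. i < m \<Longrightarrow> K i ` {..m} = {..m}" and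
    kept: "\<And>i j. i < m \<Longrightarrow> i + j < m \<Longrightarrow> K i j = L i j" "\<And>i j. i < m \<Longrightarrow> i + j = m \<Longrightarrow> K i j = m" and
    z: "\<And>j. j \<in> {1..<m} \<Longrightarrow> z j \<in> (\<lambda>i. L i j) ` {..<m}" and
    cols: "\<And>j. j \<in> {1..<m} \<Longrightarrow> (\<lambda>i. K i j) ` {..<m} = insert m ((\<lambda>i. L i j) ` {..<m} - {z j})" and
    last: "(\<lambda>i. K i m) ` {..<m} = insert m (z ` {1..<m})" and inj: "inj_on z {1..<m}"
    unfolding rebuilt_rows_def by auto
  have Lcol: "(\<lambda>i. L i j) ` {..<m} = {..<m}" if "j < m" for j
    using L that unfolding latin_def bij_betw_def by auto
  have zim: "z ` {1..<m} \<subseteq> {..<m}" using z Lcol by fastforce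
  have "card ({..<m} - z ` {1..<m}) = 1"
    using zim inj m by (simp add: card_Diff_subset card_image)
  then obtain x where x: "{..<m} - z ` {1..<m} = {x}" using card_1_singletonE by blast
  define new_row where "new_row = (\<lambda>j. if j = 0 then m else if j = m then x else z j)"
  define K' where "K' = K(m := new_row)"
  have K'old: "\<And>i. i < m \<Longrightarrow> K' i = K i" and K'new: "K' m = new_row" unfolding K'_def by auto
  have imK': "(\<lambda>i. K' i j) ` {..m} = insert (new_row j) ((\<lambda>i. K i j) ` {..<m})" for j
    by (auto simp: lessThan_Suc K'new K'old simp flip: lessThan_Suc_atMost)
  have row: "new_row ` {..m} = {..m}"
  proof -
    have "{..m} = insert 0 (insert m {1..<m})" using m by auto
    then have "new_row ` {..m} = insert m (insert x (z ` {1..<m}))"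
      using m by (auto simp: new_row_def image_iff)
    also have "insert x (z ` {1..<m}) = {..<m}" using x zim by auto
    also have "insert m {..<m} = {..m}" by auto
    finally show ?thesis .
  qed
  have col: "(\<lambda>i. K' i j) ` {..m} = {..m}" if "j \<le> m" for j
  proof -
    consider "j = 0" | "j \<in> {1..<m}" | "j = m" using \<open>j \<le> m\<close> by force
    then show ?thesis
    proof cases
      case 1
      have "(\<lambda>i. K i j) ` {..<m} = (\<lambda>i. L i j) ` {..<m}"
        using kept(1) unfolding 1 by (intro image_cong) auto
      then show ?thesis unfolding imK' using 1 Lcol[of 0] m by (auto simp: new_row_def)
    next
      case 2
      then show ?thesis unfolding imK' using cols[OF 2] Lcol[of j] z[OF 2] by (auto simp: new_row_def)
    next
      case 3
      have "insert x (z ` {1..<m}) = {..<m}" using x zim by auto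
      moreover have "new_row m = x" using m by (simp add: new_row_def)
      ultimately have "insert (new_row m) (insert m (z ` {1..<m})) = insert m {..<m}" by blast
      also have "\<dots> = {..m}" by auto
      finally show ?thesis unfolding imK' 3 last .
    qed
  qed
  have "latin {..m} {..m} {..m} K'"
    unfolding latin_def
  proof (intro conjI ballI surj_imp_bij_betw)
    show "K' i ` {..m} = {..m}" if "i \<in> {..m}" for i
      using that rows row K'old K'new by (cases "i = m") auto
  qed (use col in auto)
  moreover have "(i + j < m \<longrightarrow> K' i j = L i j) \<and> (i + j = m \<longrightarrow> K' i j = m)" if "i \<le> m" "j \<le> m" for i j
    using that kept K'old K'new by (cases "i = m") (auto simp: new_row_def)
  ultimately show ?thesis by blast
qed

section \<open>Placing few cells above the antidiagonal\<close>

text \<open>The inductive step for the orderings below. The empty row \<open>r\<close> goes last and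
  column \<open>c\<close> first, which shifts the other columns by one. Cells in column
  \<open>c\<close> end up above the antidiagonal because their row is not the last; for the other
  cells both sides of the inequality grow by 1.\<close>

lemma peel_row_and_column:
  assumes "r \<in> R" "c \<in> C" "r \<notin> fst ` B" "B \<subseteq> R \<times> C"
    and \<rho>: "bij_betw \<rho> (R - {r}) {..<m}" and \<gamma>: "bij_betw \<gamma> (C - {c}) {..<m}"
    and B: "\<And>i j. \<lbrakk>(i, j) \<in> B; j \<noteq> c\<rbrakk> \<Longrightarrow> \<rho> i + \<gamma> j + 1 < m"
  shows "\<exists>\<rho>' \<gamma>'. bij_betw \<rho>' R {..<Suc m} \<and> bij_betw \<gamma>' C {..<Suc m} \<and> \<rho>' r = m \<and> \<gamma>' c = 0 \<and>
    (\<forall>i. i \<noteq> r \<longrightarrow> \<rho>' i = \<rho> i) \<and> (\<forall>j. j \<noteq> c \<longrightarrow> \<gamma>' j = Suc (\<gamma> j)) \<and>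
    (\<forall>(i, j)\<in>B. \<rho>' i + \<gamma>' j + 1 < Suc m)"
proof -
  define \<rho>' where "\<rho>' = \<rho>(r := m)"
  define \<gamma>' where "\<gamma>' = (\<lambda>j. if j = c then 0 else Suc (\<gamma> j))"
  have "bij_betw \<rho>' (R - {r}) {..<m}"
    using \<rho> by (rule bij_betw_cong[THEN iffD1, rotated]) (auto simp: \<rho>'_def)
  then have "bij_betw \<rho>' (insert r (R - {r})) (insert (\<rho>' r) {..<m})"
    by (subst notIn_Un_bij_betw3[symmetric, unfolded Un_insert_right Un_empty_right]) (auto simp: \<rho>'_def)
  moreover have "insert r (R - {r}) = R" "insert (\<rho>' r) {..<m} = {..<Suc m}"
    using assms(1) by (auto simp: \<rho>'_def lessThan_Suc)
  ultimately have 1: "bij_betw \<rho>' R {..<Suc m}" by simp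
  have "bij_betw (Suc \<circ> \<gamma>) (C - {c}) (Suc ` {..<m})"
    by (rule bij_betw_trans[OF \<gamma>]) (simp add: bij_betw_def)
  then have "bij_betw \<gamma>' (C - {c}) (Suc ` {..<m})"
    by (rule bij_betw_cong[THEN iffD1, rotated]) (auto simp: \<gamma>'_def)
  then have "bij_betw \<gamma>' (insert c (C - {c})) (insert (\<gamma>' c) (Suc ` {..<m}))"
    by (subst notIn_Un_bij_betw3[symmetric, unfolded Un_insert_right Un_empty_right]) (auto simp: \<gamma>'_def)
  moreover have "insert c (C - {c}) = C" "insert (\<gamma>' c) (Suc ` {..<m}) = {..<Suc m}"
    using assms(2) by (auto simp: \<gamma>'_def lessThan_Suc_eq_insert_0)
  ultimately have 2: "bij_betw \<gamma>' C {..<Suc m}" by simp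
  have 3: "\<rho>' i + \<gamma>' j + 1 < Suc m" if ij: "(i, j) \<in> B" for i j
  proof -
    have i: "i \<in> R - {r}" using ij assms(3,4) by force
    then have "\<rho> i < m" using \<rho> bij_betwE by blast
    then show ?thesis using B[OF ij] i by (auto simp: \<rho>'_def \<gamma>'_def)
  qed
  show ?thesis
  proof (intro exI[of _ \<rho>'] exI[of _ \<gamma>'] conjI)
    show "\<forall>(i, j)\<in>B. \<rho>' i + \<gamma>' j + 1 < Suc m" using 3 by blast
  qed (use 1 2 in \<open>auto simp: \<rho>'_def \<gamma>'_def\<close>)
qed

lemma empty_row_exists:
  assumes "finite B" "card B < card R"
  shows "\<exists>r\<in>R. r \<notin> fst ` B"
proof (rule ccontr)
  assume "\<not> ?thesis"
  then have "R \<subseteq> fst ` B" by auto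
  then have "card R \<le> card B" using assms(1) by (meson surj_card_le)
  then show False using assms(2) by simp
qed

text \<open>Delete a column that meets \<open>B\<close> and a row that does not; the latter exists
  because \<open>B\<close> has fewer cells than there are rows. At least one cell disappears, so
  induction applies to the rest.\<close>

lemma staircase:
  assumes "finite R" "finite C" "card R = n" "card C = n" "B \<subseteq> R \<times> C" "card B < n"
  shows "\<exists>\<rho> \<gamma>. bij_betw \<rho> R {..<n} \<and> bij_betw \<gamma> C {..<n} \<and> (\<forall>(i, j)\<in>B. \<rho> i + \<gamma> j + 1 < n)"
  using assms
proof (induction n arbitrary: R C B)
  case 0
  then show ?case by simp
next
  case (Suc m)
  have fin: "finite B" using Suc.prems finite_subset by blast
  show ?case
  proof (cases "B = {}")
    case True
    then show ?thesis
      using ex_bij_betw_finite_nat[OF Suc.prems(1)] ex_bij_betw_finite_nat[OF Suc.prems(2)] Suc.prems(3,4)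
      by (auto simp: atLeast0LessThan)
  next
    case False
    then obtain i c where ic: "(i, c) \<in> B" by auto
    obtain r where r: "r \<in> R" "r \<notin> fst ` B"
      using empty_row_exists[OF fin, of R] Suc.prems by auto
    define B' where "B' = {x \<in> B. snd x \<noteq> c}"
    have "(i, c) \<in> B - B'" "B' \<subseteq> B" using ic unfolding B'_def by auto
    then have "B' \<subset> B" by blast
    then have "card B' < card B" by (rule psubset_card_mono[OF fin])
    then have "card B' < m" using Suc.prems(6) by simp
    moreover have "B' \<subseteq> (R - {r}) \<times> (C - {c})" using r Suc.prems(5) unfolding B'_def by force
    moreover have c: "c \<in> C" using ic Suc.prems(5) by auto
    moreover have "card (R - {r}) = m" "card (C - {c}) = m" using Suc.prems(1-4) r c by auto
    ultimately obtain \<rho> \<gamma> where \<rho>: "bij_betw \<rho> (R - {r}) {..<m}" and \<gamma>: "bij_betw \<gamma> (C - {c}) {..<m}"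
      and B': "\<forall>(i, j)\<in>B'. \<rho> i + \<gamma> j + 1 < m"
      using Suc.IH[of "R - {r}" "C - {c}" B'] Suc.prems(1,2) by blast
    have "\<rho> i + \<gamma> j + 1 < m" if "(i, j) \<in> B" "j \<noteq> c" for i j
      using B' that unfolding B'_def by auto
    from peel_row_and_column[OF r(1) c r(2) Suc.prems(5) \<rho> \<gamma> this] show ?thesis by blast
  qed
qed

text \<open>If row \<open>r\<close> is empty, make it the last row and \<open>c\<close> the first
  column: this puts \<open>(r, c)\<close> on the antidiagonal. Otherwise peel off the column
  \<open>c'\<close> of a cell in row \<open>r\<close>, together with an empty row. This keeps
  \<open>(r, c)\<close> and the cell \<open>(i, c)\<close>, and \<open>(r, c)\<close> stays on the
  antidiagonal because column \<open>c\<close> and the order both shift by 1.\<close>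

lemma staircase_with_corner_column:
  assumes "finite R" "finite C" "card R = n" "card C = n" "B \<subseteq> R \<times> C" "card B < n"
    and "r \<in> R" "(r, c) \<notin> B" "(i, c) \<in> B"
  shows "\<exists>\<rho> \<gamma>. bij_betw \<rho> R {..<n} \<and> bij_betw \<gamma> C {..<n} \<and> \<rho> r + \<gamma> c + 1 = n \<and>
    (\<forall>(i, j)\<in>B. \<rho> i + \<gamma> j + 1 < n)"
  using assms
proof (induction n arbitrary: R C B)
  case 0
  then show ?case by simp
next
  case (Suc m)
  have fin: "finite B" using Suc.prems finite_subset by blast
  have c: "c \<in> C" using Suc.prems by auto
  have drop: "card {x \<in> B. snd x \<noteq> c'} < m" if "(i', c') \<in> B" for i' c'
  proof -
    have "(i', c') \<in> B - {x \<in> B. snd x \<noteq> c'}" using that by simp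
    then have "{x \<in> B. snd x \<noteq> c'} \<subset> B" by blast
    then have "card {x \<in> B. snd x \<noteq> c'} < card B" by (rule psubset_card_mono[OF fin])
    then show ?thesis using Suc.prems(6) by simp
  qed
  show ?case
  proof (cases "r \<in> fst ` B")
    case False
    define B' where "B' = {x \<in> B. snd x \<noteq> c}"
    have "B' \<subseteq> (R - {r}) \<times> (C - {c})" using False Suc.prems(5) unfolding B'_def by force
    moreover have "card B' < m" unfolding B'_def by (rule drop[OF Suc.prems(9)])
    moreover have "card (R - {r}) = m" "card (C - {c}) = m" using Suc.prems(1-4,7) c by auto
    ultimately obtain \<rho> \<gamma> where \<rho>: "bij_betw \<rho> (R - {r}) {..<m}" and \<gamma>: "bij_betw \<gamma> (C - {c}) {..<m}"
      and B': "\<forall>(i, j)\<in>B'. \<rho> i + \<gamma> j + 1 < m"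
      using staircase[of "R - {r}" "C - {c}" m B'] Suc.prems(1,2) by blast
    have *: "\<rho> i + \<gamma> j + 1 < m" if "(i, j) \<in> B" "j \<noteq> c" for i j
      using B' that unfolding B'_def by auto
    obtain \<rho>' \<gamma>' where "bij_betw \<rho>' R {..<Suc m}" "bij_betw \<gamma>' C {..<Suc m}" "\<rho>' r = m" "\<gamma>' c = 0"
      "\<forall>(i, j)\<in>B. \<rho>' i + \<gamma>' j + 1 < Suc m"
      using peel_row_and_column[OF Suc.prems(7) c False Suc.prems(5) \<rho> \<gamma> *] by blast
    then show ?thesis by (intro exI[of _ \<rho>'] exI[of _ \<gamma>']) auto
  next
    case True
    then obtain c' where c': "(r, c') \<in> B" by auto
    then have c'C: "c' \<in> C" and c'c: "c' \<noteq> c" using Suc.prems by auto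
    obtain r' where r': "r' \<in> R" "r' \<notin> fst ` B"
      using empty_row_exists[OF fin, of R] Suc.prems by auto
    then have r'r: "r' \<noteq> r" using True by auto
    define B' where "B' = {x \<in> B. snd x \<noteq> c'}"
    have "B' \<subseteq> (R - {r'}) \<times> (C - {c'})" using r' Suc.prems(5) unfolding B'_def by force
    moreover have "(r, c) \<notin> B'" "(i, c) \<in> B'" using Suc.prems c'c unfolding B'_def by auto
    moreover have "card B' < m" unfolding B'_def by (rule drop[OF c'])
    moreover have "card (R - {r'}) = m" "card (C - {c'}) = m" using Suc.prems(1-4) r' c'C by auto
    moreover have "r \<in> R - {r'}" using Suc.prems(7) r'r by blast
    ultimately obtain \<rho> \<gamma> where \<rho>: "bij_betw \<rho> (R - {r'}) {..<m}" and \<gamma>: "bij_betw \<gamma> (C - {c'}) {..<m}"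
      and rc: "\<rho> r + \<gamma> c + 1 = m" and B': "\<forall>(i, j)\<in>B'. \<rho> i + \<gamma> j + 1 < m"
      using Suc.IH[of "R - {r'}" "C - {c'}" B'] Suc.prems(1,2) by blast
    have *: "\<rho> i + \<gamma> j + 1 < m" if "(i, j) \<in> B" "j \<noteq> c'" for i j
      using B' that unfolding B'_def by auto
    obtain \<rho>' \<gamma>' where "bij_betw \<rho>' R {..<Suc m}" "bij_betw \<gamma>' C {..<Suc m}"
      "\<forall>i. i \<noteq> r' \<longrightarrow> \<rho>' i = \<rho> i" "\<forall>j. j \<noteq> c' \<longrightarrow> \<gamma>' j = Suc (\<gamma> j)"
      "\<forall>(i, j)\<in>B. \<rho>' i + \<gamma>' j + 1 < Suc m"
      using peel_row_and_column[OF r'(1) c'C r'(2) Suc.prems(5) \<rho> \<gamma> *] by blast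
    then show ?thesis using rc c'c r'r by (intro exI[of _ \<rho>'] exI[of _ \<gamma>']) auto
  qed
qed

definition nonisolated :: "('a \<times> 'b) set \<Rightarrow> 'a \<times> 'b \<Rightarrow> bool" where
  "nonisolated A e \<longleftrightarrow> (\<exists>x\<in>A. x \<noteq> e \<and> (fst x = fst e \<or> snd x = snd e))"

text \<open>Without the cell \<open>(r, c)\<close> only \<open>n - 1\<close> cells remain, and one
  of them shares its column or its row. The case of a common row is the transpose of the
  other.\<close>

lemma staircase_with_corner:
  assumes "finite R" "finite C" "card R = n" "card C = n" "A \<subseteq> R \<times> C" "card A = n"
    and e: "(r, c) \<in> A" and "nonisolated A (r, c)"
  shows "\<exists>\<rho> \<gamma>. bij_betw \<rho> R {..<n} \<and> bij_betw \<gamma> C {..<n} \<and> \<rho> r + \<gamma> c + 1 = n \<and>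
    (\<forall>(i, j)\<in>A - {(r, c)}. \<rho> i + \<gamma> j + 1 < n)"
proof -
  have fin: "finite A" using assms finite_subset by blast
  define B where "B = A - {(r, c)}"
  have B: "B \<subseteq> R \<times> C" "(r, c) \<notin> B" "r \<in> R" "c \<in> C" using assms unfolding B_def by auto
  have cB: "card B < n"
    using card_Diff1_less[OF fin e] assms unfolding B_def by simp
  obtain i j where x: "(i, j) \<in> B" "i = r \<or> j = c" using assms(8) unfolding nonisolated_def B_def by fastforce
  show ?thesis
  proof (cases "j = c")
    case True
    then show ?thesis
      using staircase_with_corner_column[OF assms(1-4) B(1) cB B(3,2)] x unfolding B_def by auto
  next
    case False
    then have "(c, r) \<notin> B\<inverse>" "(j, r) \<in> B\<inverse>" "B\<inverse> \<subseteq> C \<times> R" using x B by auto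
    moreover have "card (B\<inverse>) < n" using cB by (simp add: card_inverse)
    ultimately obtain \<gamma> \<rho> where "bij_betw \<gamma> C {..<n}" "bij_betw \<rho> R {..<n}" "\<gamma> c + \<rho> r + 1 = n"
      "\<forall>(j, i)\<in>B\<inverse>. \<gamma> j + \<rho> i + 1 < n"
      using staircase_with_corner_column[of C R n "B\<inverse>" c r j] assms(1-4) B(4) by auto
    then show ?thesis unfolding B_def[symmetric]
      by (intro exI[of _ \<rho>] exI[of _ \<gamma>]) (auto simp: add.commute)
  qed
qed

section \<open>Latin squares with a transversal\<close>

lemma double_mod_inj:
  fixes m :: nat
  assumes "odd m" "i < m" "j < m" "(i + i) mod m = (j + j) mod m"
  shows "i = j"
proof -
  have "[2 * i = 2 * j] (mod m)" using assms(4) by (simp add: cong_def mult_2)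
  moreover have "coprime 2 m" using assms(1) by simp
  ultimately have "[i = j] (mod m)" using cong_mult_lcancel_nat by blast
  then show ?thesis using assms by (simp add: cong_def)
qed

lemma add_mod_inj:
  fixes m :: nat
  assumes "i < m" "j < m" "(k + i) mod m = (k + j) mod m"
  shows "i = j"
proof -
  have "[k + i = k + j] (mod m)" using assms(3) by (simp add: cong_def)
  then have "[i = j] (mod m)" by (simp add: cong_add_lcancel_nat)
  then show ?thesis using assms by (simp add: cong_def)
qed

lemma latinI:
  assumes "finite S" "card R = card S" "card C = card S"
    and "\<And>i j. \<lbrakk>i \<in> R; j \<in> C\<rbrakk> \<Longrightarrow> L i j \<in> S"
    and "\<And>i j j'. \<lbrakk>i \<in> R; j \<in> C; j' \<in> C; L i j = L i j'\<rbrakk> \<Longrightarrow> j = j'"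
    and "\<And>i i' j. \<lbrakk>i \<in> R; i' \<in> R; j \<in> C; L i j = L i' j\<rbrakk> \<Longrightarrow> i = i'"
  shows "latin R C S L"
  unfolding latin_def using assms by (intro conjI ballI inj_imp_bij_betw) (auto intro!: inj_onI)

lemma cyclic_latin:
  fixes n :: nat
  shows "latin {..<n} {..<n} {..<n} (\<lambda>i j. (i + j) mod n)"
proof (rule latinI)
  fix i i' j assume "i \<in> {..<n}" "i' \<in> {..<n}" "(i + j) mod n = (i' + j) mod n"
  then show "i = i'" using add_mod_inj[of i n i' j] by (simp add: add.commute)
qed (use add_mod_inj in auto)

text \<open>
  For even order the transversal \<open>{(i, i + 1)}\<close> of the cyclic square of order \<open>m = n - 1\<close> is
  replaced by a new symbol, and its former symbols move to the new last row and last column.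
\<close>

lemma latin_transversal:
  fixes n :: nat
  assumes "n \<noteq> 2"
  shows "\<exists>L. latin {..<n} {..<n} {..<n} L \<and> inj_on (\<lambda>i. L i i) {..<n}"
proof (cases "odd n")
  \<comment> \<open>The main diagonal of the cyclic square carries the symbols \<open>2 * i\<close>
    modulo \<open>n\<close>, which are distinct for odd \<open>n\<close>.\<close>
  case True
  then show ?thesis
    by (intro exI[of _ "\<lambda>i j. (i + j) mod n"] conjI cyclic_latin inj_onI) (auto dest: double_mod_inj)
next
  case False
  show ?thesis
  proof (cases "n = 0")
    case True
    then show ?thesis by (auto simp: latin_def)
  next
    case n0: False
    then obtain m where n: "n = Suc m" by (cases n) auto
    have m: "odd m" "m \<ge> 3" using n False assms n0 by (auto, presburger)
    \<comment> \<open>The transversal to be replaced consists of the cells \<open>(i, s i)\<close>;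
      \<open>q\<close> below is the inverse of \<open>s\<close>, so that column \<open>j\<close>
      loses its symbol in row \<open>q j\<close>.\<close>
    define s where "s = (\<lambda>i. Suc i mod m)"
    have s: "s i < m" "s i \<noteq> i" if "i < m" for i
      using that m unfolding s_def by (auto simp: mod_Suc)
    have s_inj: "i = j" if "i < m" "j < m" "s i = s j" for i j
      using that add_mod_inj[of i m j 1] unfolding s_def by simp
    define q where "q = (\<lambda>j. if j = 0 then m - 1 else j - 1)"
    have q: "q j < m" "s (q j) = j" if "j < m" for j
      using that m unfolding s_def q_def by (auto simp: mod_Suc)
    have qs: "q (s i) = i" if "i < m" for i
      using that m unfolding s_def q_def by (auto simp: mod_Suc)
    define f where "f = (\<lambda>i j. (i + j) mod m)"
    have f: "f i j < m" for i j using m unfolding f_def by simp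
    have f_inj: "j = j'" if "i < m" "j < m" "j' < m" "f i j = f i j'" for i j j'
      using that add_mod_inj unfolding f_def by blast
    have f_com: "f i j = f j i" for i j unfolding f_def by (simp add: add.commute)
    \<comment> \<open>Modulo \<open>m\<close> this is \<open>2 * i + 1\<close>; as \<open>m\<close>
      is odd, these symbols are distinct.\<close>
    define d where "d = (\<lambda>i. f i (s i))"
    have d: "d i < m" for i using f d_def by simp
    have d_inj: "i = j" if "i < m" "j < m" "d i = d j" for i j
    proof -
      have "(1 + (i + i) mod m) mod m = (1 + (j + j) mod m) mod m"
        using that unfolding d_def f_def s_def by (simp add: mod_simps)
      then have "(i + i) mod m = (j + j) mod m" using add_mod_inj[of "(i+i) mod m" m "(j+j) mod m" 1] m by simp
      then show ?thesis using double_mod_inj[OF m(1)] that by blast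
    qed
    define L where "L = (\<lambda>i j. if i = m then (if j = m then m else d (q j))
      else if j = m then d i else if j = s i then m else f i j)"
    have "latin {..<n} {..<n} {..<n} L"
    proof (rule latinI)
      show "L i j \<in> {..<n}" for i j
        using f[of i j] d[of i] d[of "q j"] unfolding L_def n by auto
    next
      fix i j j' assume a: "i \<in> {..<n}" "j \<in> {..<n}" "j' \<in> {..<n}" "L i j = L i j'"
      show "j = j'"
      proof (cases "i = m")
        case True
        have "L i j = m \<longleftrightarrow> j = m" for j using True d[of "q j"] unfolding L_def by auto
        then have "j = m \<longleftrightarrow> j' = m" using a(4) by metis
        moreover have "j = j'" if "j < m" "j' < m"
        proof -
          have "d (q j) = d (q j')" using a(4) that True unfolding L_def by simp
          then have "q j = q j'" using d_inj q(1) that by blast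
          then show ?thesis using q(2) that by metis
        qed
        ultimately show ?thesis using a unfolding n by (auto simp: less_Suc_eq)
      next
        case False
        then have i: "i < m" using a unfolding n by simp
        \<comment> \<open>In row \<open>i\<close> the symbol \<open>m\<close> occurs only in column
          \<open>s i\<close> and \<open>d i\<close> only in the last column, while the other entries
          are those of the cyclic square. Columns are treated alike, with \<open>q j\<close> for
          \<open>s i\<close>.\<close>
        have sj: "L i j = m \<longleftrightarrow> j = s i" for j
          using i d[of i] f[of i j] s(1)[OF i] unfolding L_def by auto
        have dj: "L i j = d i \<longleftrightarrow> j = m" if "j \<in> {..<n}" for j
        proof (cases "j = m")
          case True
          then show ?thesis using i unfolding L_def by simp
        next
          case False
          then have jm: "j < m" using that unfolding n by simp
          have "L i j \<noteq> d i"
          proof (cases "j = s i")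
            case True
            then show ?thesis using sj[of j] d[of i] by simp
          next
            case js: False
            then have "L i j = f i j" using i jm unfolding L_def by simp
            moreover have "f i j \<noteq> f i (s i)" using f_inj[OF i jm s(1)[OF i]] js by blast
            ultimately show ?thesis unfolding d_def by simp
          qed
          then show ?thesis using False by simp
        qed
        have fj: "L i j = f i j" if "j \<noteq> m" "j \<noteq> s i" for j using i that unfolding L_def by simp
        consider "j = s i" | "j = m" | "j \<noteq> m" "j \<noteq> s i" by blast
        then show ?thesis
        proof cases
          case 1
          then have "L i j' = m" using sj[of j] a(4) by metis
          then show ?thesis using 1 sj[of j'] by metis
        next
          case 2
          then have "L i j' = d i" using dj a by metis
          then show ?thesis using 2 dj a by metis
        next
          case 3
          then have 4: "j' \<noteq> m" "j' \<noteq> s i" using sj[of j] sj[of j'] dj[of j] dj[of j'] a by metis+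
          then have "f i j = f i j'" using 3 fj[of j] fj[of j'] a by simp
          moreover have "j < m" "j' < m" using a 3 4 unfolding n by auto
          ultimately show ?thesis using f_inj i by blast
        qed
      qed
    next
      fix i i' j assume a: "i \<in> {..<n}" "i' \<in> {..<n}" "j \<in> {..<n}" "L i j = L i' j"
      show "i = i'"
      proof (cases "j = m")
        case True
        have "L i j = m \<longleftrightarrow> i = m" for i using True d[of i] unfolding L_def by auto
        then have "i = m \<longleftrightarrow> i' = m" using a(4) by metis
        moreover have "i = i'" if "i < m" "i' < m"
          using a(4) that True d_inj[of i i'] unfolding L_def by auto
        ultimately show ?thesis using a unfolding n by (auto simp: less_Suc_eq)
      next
        case False
        then have j: "j < m" using a unfolding n by simp
        have sj: "L i j = m \<longleftrightarrow> i = q j" if "i \<in> {..<n}" for i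
        proof (cases "i = m")
          case True
          then show ?thesis using j d[of "q j"] q(1)[OF j] unfolding L_def by simp
        next
          case False
          then have im: "i < m" using that unfolding n by simp
          then have "L i j = m \<longleftrightarrow> j = s i" using j f[of i j] unfolding L_def by simp
          then show ?thesis using qs[OF im] q(2)[OF j] by metis
        qed
        have dj: "L i j = d (q j) \<longleftrightarrow> i = m" if "i \<in> {..<n}" for i
        proof (cases "i = m")
          case True
          then show ?thesis using j unfolding L_def by simp
        next
          case False
          then have im: "i < m" using that unfolding n by simp
          have "L i j \<noteq> d (q j)"
          proof (cases "i = q j")
            case True
            then show ?thesis using sj[OF that] d[of "q j"] by simp
          next
            case iq: False
            then have "j \<noteq> s i" using qs[OF im] by auto
            then have "L i j = f i j" using im j unfolding L_def by simp
            moreover have "f j i \<noteq> f j (q j)" using f_inj[OF j im q(1)[OF j]] iq by blast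
            moreover have "d (q j) = f j (q j)" using q(2)[OF j] f_com[of j] unfolding d_def by simp
            ultimately show ?thesis using f_com[of i j] by simp
          qed
          then show ?thesis using False by simp
        qed
        have fj: "L i j = f i j" if "i \<noteq> m" "i \<noteq> q j" "i \<in> {..<n}" for i
        proof -
          have im: "i < m" using that unfolding n by simp
          then have "j \<noteq> s i" using qs[OF im] that(2) by auto
          then show ?thesis using im j unfolding L_def by simp
        qed
        consider "i = q j" | "i = m" | "i \<noteq> m" "i \<noteq> q j" by blast
        then show ?thesis
        proof cases
          case 1
          then have "L i' j = m" using sj a by metis
          then show ?thesis using 1 sj a by metis
        next
          case 2
          then have "L i' j = d (q j)" using dj a by metis
          then show ?thesis using 2 dj a by metis
        next
          case 3
          then have 4: "i' \<noteq> m" "i' \<noteq> q j" using sj[of i] sj[of i'] dj[of i] dj[of i'] a by metis+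
          then have "f j i = f j i'" using 3 fj[of i] fj[of i'] a f_com[of j] by simp
          moreover have "i < m" "i' < m" using a 3 4 unfolding n by auto
          ultimately show ?thesis using f_inj j by blast
        qed
      qed
    qed auto
    \<comment> \<open>Since \<open>s i\<close> differs from \<open>i\<close>, the main diagonal
      avoids the replaced cells: it keeps \<open>2 * i\<close> modulo \<open>m\<close> and has
      \<open>m\<close> in the corner.\<close>
    moreover have "inj_on (\<lambda>i. L i i) {..<n}"
    proof (rule inj_onI)
      fix i j assume ij: "i \<in> {..<n}" "j \<in> {..<n}" "L i i = L j j"
      have diag: "L i i = f i i" if "i < m" for i using that s(2)[OF that] unfolding L_def by simp
      have Lm: "L m m = m" unfolding L_def by simp
      have "i = m \<longleftrightarrow> j = m"
        using ij diag[of i] diag[of j] f[of i i] f[of j j] Lm unfolding n by (auto simp: less_Suc_eq)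
      moreover have "i = j" if "i < m" "j < m"
        using ij(3) diag that double_mod_inj[OF m(1) that] unfolding f_def by simp
      ultimately show "i = j" using ij unfolding n by (auto simp: less_Suc_eq)
    qed
    ultimately show ?thesis by blast
  qed
qed

text \<open>Here \<open>A\<close> has one cell in each row and each column, so numbering every line
  by its cell in \<open>A\<close> turns \<open>A\<close> into the main diagonal.\<close>

lemma rainbow_matching:
  assumes "finite R" "finite C" "card R = n" "card C = n" "A \<subseteq> R \<times> C" "card A = n" "n \<noteq> 2"
    and "inj_on fst A" "inj_on snd A"
  shows "\<exists>L. latin R C {..<n} L \<and> rainbow L A"
proof -
  have fin: "finite A" using assms finite_subset by blast
  obtain h where h: "bij_betw h A {..<n}"
    using ex_bij_betw_finite_nat[OF fin] assms(6) by (auto simp: atLeast0LessThan)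
  have "bij_betw fst A R" "bij_betw snd A C" using assms by (auto intro!: inj_imp_bij_betw)
  then have \<rho>: "bij_betw (h \<circ> inv_into A fst) R {..<n}" and \<gamma>: "bij_betw (h \<circ> inv_into A snd) C {..<n}"
    using h by (auto intro: bij_betw_trans bij_betw_inv_into)
  obtain L where L: "latin {..<n} {..<n} {..<n} L" "inj_on (\<lambda>i. L i i) {..<n}"
    using latin_transversal[OF \<open>n \<noteq> 2\<close>] by blast
  let ?K = "\<lambda>i j. L ((h \<circ> inv_into A fst) i) ((h \<circ> inv_into A snd) j)"
  have inv: "inv_into A fst i = (i, j)" "inv_into A snd j = (i, j)" if "(i, j) \<in> A" for i j
    using inv_into_f_f[OF assms(8) that] inv_into_f_f[OF assms(9) that] by auto
  have "rainbow ?K A"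
  proof (rule rainbowI)
    fix i j i' j' assume a: "(i, j) \<in> A" "(i', j') \<in> A" "?K i j = ?K i' j'"
    then have "L (h (i, j)) (h (i, j)) = L (h (i', j')) (h (i', j'))" using inv by simp
    moreover have "h (i, j) \<in> {..<n}" "h (i', j') \<in> {..<n}" using h a bij_betwE by blast+
    ultimately have "h (i, j) = h (i', j')" using L(2) unfolding inj_on_def by blast
    then show "i = i' \<and> j = j'" using h a unfolding bij_betw_def inj_on_def by blast
  qed
  then show ?thesis using latin_transport[OF L(1) \<rho> \<gamma>] by blast
qed

section \<open>Rainbow sets in Latin squares\<close>

text \<open>
  For a set of \<open>n\<close> cells of an array of order \<open>n\<close>, being improper means to consist of a nonempty
  part of a row and a nonempty part of a column, without a common row or column. Unlike
  \<open>improper\<close>, this does not mention the array.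
\<close>

definition two_stars :: "('a \<times> 'b) set \<Rightarrow> bool" where
  "two_stars A \<longleftrightarrow> (\<exists>i j. (\<forall>x\<in>A. (fst x = i) \<noteq> (snd x = j)) \<and> (\<exists>x\<in>A. fst x = i) \<and> (\<exists>x\<in>A. snd x = j))"

section \<open>Criteria for being or not being two stars\<close>

lemma two_starsI:
  assumes "\<And>a b. (a, b) \<in> A \<Longrightarrow> (a = i) \<noteq> (b = j)" "(i, c) \<in> A" "(r, j) \<in> A"
  shows "two_stars A"
  unfolding two_stars_def using assms by (intro exI[of _ i] exI[of _ j]) fastforce

lemma two_starsD:
  assumes "two_stars A"
  shows "\<exists>i j c r. (\<forall>a b. (a, b) \<in> A \<longrightarrow> (a = i) \<noteq> (b = j)) \<and> (i, c) \<in> A \<and> (r, j) \<in> A"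
  using assms unfolding two_stars_def by fastforce

lemma two_stars_converse: "two_stars (A\<inverse>) \<longleftrightarrow> two_stars A"
proof -
  have *: "two_stars (B\<inverse>)" if B: "two_stars B" for B :: "('c \<times> 'd) set"
  proof -
    obtain i j c r where "\<And>a b. (a, b) \<in> B \<Longrightarrow> (a = i) \<noteq> (b = j)" "(i, c) \<in> B" "(r, j) \<in> B"
      using two_starsD[OF B] by blast
    then show ?thesis by (intro two_starsI[of "B\<inverse>" j i r c]) auto
  qed
  show ?thesis using *[of A] *[of "A\<inverse>"] by auto
qed

lemma nonisolated_converse: "nonisolated (A\<inverse>) (c, r) \<longleftrightarrow> nonisolated A (r, c)"
  unfolding nonisolated_def by force

lemma nonisolatedI:
  assumes "(a, b) \<in> A" "(a, b) \<noteq> (r, c)" "a = r \<or> b = c"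
  shows "nonisolated A (r, c)"
  unfolding nonisolated_def using assms by force

text \<open>The middle cell \<open>(b, x)\<close> would lie on exactly one of the two lines; the end
  cell that does not share this line then lies on neither.\<close>

lemma not_two_stars_path:
  assumes "(a, x) \<in> A" "(b, x) \<in> A" "(b, y) \<in> A" "a \<noteq> b" "x \<noteq> y"
  shows "\<not> two_stars A"
proof
  assume "two_stars A"
  then obtain i j where "\<And>a b. (a, b) \<in> A \<Longrightarrow> (a = i) \<noteq> (b = j)" using two_starsD by blast
  from this[OF assms(1)] this[OF assms(2)] this[OF assms(3)] show False using assms(4,5) by auto
qed

text \<open>One row and one column cover at most two cells that pairwise share no line.\<close>

lemma not_two_stars_matching:
  assumes "(a, x) \<in> A" "(b, y) \<in> A" "(c, z) \<in> A" "distinct [a, b, c]" "distinct [x, y, z]"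
  shows "\<not> two_stars A"
proof
  assume "two_stars A"
  then obtain i j where "\<And>a b. (a, b) \<in> A \<Longrightarrow> (a = i) \<noteq> (b = j)" using two_starsD by blast
  from this[OF assms(1)] this[OF assms(2)] this[OF assms(3)] show False using assms(4,5) by auto
qed

text \<open>The row meets at most one of the pairs, and the column covers at most one cell of the
  other pair.\<close>

lemma not_two_stars_rows:
  assumes "(a, x) \<in> A" "(a, y) \<in> A" "(b, u) \<in> A" "(b, v) \<in> A" "a \<noteq> b" "x \<noteq> y" "u \<noteq> v"
  shows "\<not> two_stars A"
proof
  assume "two_stars A"
  then obtain i j where "\<And>a b. (a, b) \<in> A \<Longrightarrow> (a = i) \<noteq> (b = j)" using two_starsD by blast
  from this[OF assms(1)] this[OF assms(2)] this[OF assms(3)] this[OF assms(4)]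
  show False using assms(5-) by auto
qed

lemma not_two_stars_row:
  assumes "\<And>a b. (a, b) \<in> A \<Longrightarrow> a = i"
  shows "\<not> two_stars A"
proof
  assume "two_stars A"
  then obtain i j c r where star: "\<And>a b. (a, b) \<in> A \<Longrightarrow> (a = i) \<noteq> (b = j)" "(i, c) \<in> A" "(r, j) \<in> A"
    using two_starsD by blast
  then show False using assms star(1)[OF star(2)] star(1)[OF star(3)] by blast
qed

lemma not_two_stars_column:
  assumes "\<And>a b. (a, b) \<in> A \<Longrightarrow> b = j"
  shows "\<not> two_stars A"
proof
  assume "two_stars A"
  then obtain i j c r where star: "\<And>a b. (a, b) \<in> A \<Longrightarrow> (a = i) \<noteq> (b = j)" "(i, c) \<in> A" "(r, j) \<in> A"
    using two_starsD by blast
  then show False using assms star(1)[OF star(2)] star(1)[OF star(3)] by blast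
qed

section \<open>Removing a cell without creating two stars\<close>

definition two_row_pairs :: "('a \<times> 'b) set \<Rightarrow> bool" where
  "two_row_pairs A \<longleftrightarrow> (\<exists>a b x y u v. a \<noteq> b \<and> distinct [x, y, u, v] \<and> A = {(a, x), (a, y), (b, u), (b, v)})"

text \<open>The exceptional set is approached one line at a time: column \<open>j\<close> contains
  only \<open>(r0, j)\<close>, row \<open>i\<close> has at least two cells, none of them in column
  \<open>c0\<close>, and no third one. Any violation allows deleting a nonisolated cell so that a
  path, a matching, two row pairs or a single row remains, against \<open>H\<close>, or makes
  \<open>A\<close> itself two stars.\<close>

lemma two_row_pairs_critical:
  assumes A: "\<not> two_stars A"
    and H: "\<And>r c. \<lbrakk>(r, c) \<in> A; nonisolated A (r, c)\<rbrakk> \<Longrightarrow> two_stars (A - {(r, c)})"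
    and star: "\<And>a b. (a, b) \<in> A \<Longrightarrow> (a, b) \<noteq> (r0, c0) \<Longrightarrow> (a = i) \<noteq> (b = j)"
    and e: "(r0, c0) \<in> A" "r0 \<noteq> i" "c0 \<noteq> j" and r0j: "(r0, j) \<in> A" and c: "(i, c) \<in> A"
  shows "two_row_pairs A"
proof -
  have cj: "c \<noteq> j" using star[OF c] e by auto
  have only: "r = r0" if "(r, j) \<in> A" for r
  proof (rule ccontr)
    assume r: "r \<noteq> r0"
    then have ri: "r \<noteq> i" using star[OF that] e by auto
    show False
    proof (cases "(i, c0) \<in> A")
      case True
      have "nonisolated A (r, j)" by (rule nonisolatedI[OF r0j]) (use r in auto)
      moreover have "\<not> two_stars (A - {(r, j)})"
        by (rule not_two_stars_path[of i c0 _ r0 j]) (use True e r0j r ri in auto)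
      ultimately show False using H that by blast
    next
      case False
      have "nonisolated A (r0, j)" by (rule nonisolatedI[OF that]) (use r in auto)
      moreover have "\<not> two_stars (A - {(r0, j)})"
        by (rule not_two_stars_matching[of i c _ r j r0 c0]) (use that e c cj r0j r ri False in auto)
      ultimately show False using H r0j by blast
    qed
  qed
  have shape: "a = i \<or> (a, b) = (r0, j) \<or> (a, b) = (r0, c0)" if "(a, b) \<in> A" for a b
    using star[OF that] only that by auto
  have other: "\<exists>c'. (i, c') \<in> A \<and> c' \<noteq> c1" for c1
  proof (rule ccontr)
    assume "\<not> ?thesis"
    then have one: "\<And>c'. (i, c') \<in> A \<Longrightarrow> c' = c1" by blast
    then have c1: "c1 = c" using c by blast
    show False
    proof (cases "c0 = c1")
      case True
      have "nonisolated A (i, c0)" by (rule nonisolatedI[OF e(1)]) (use e in auto)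
      moreover have "\<not> two_stars (A - {(i, c0)})"
        by (rule not_two_stars_row[of _ r0]) (use shape one True in auto)
      ultimately show False using H c True c1 by blast
    next
      case False
      \<comment> \<open>Now \<open>A\<close> consists of \<open>(r0, j)\<close>,
        \<open>(r0, c0)\<close> and \<open>(i, c)\<close>, a part of row \<open>r0\<close> and a
        part of column \<open>c\<close>.\<close>
      have "two_stars A"
        by (rule two_starsI[OF _ r0j c]) (use shape one c1 False e cj in auto)
      then show False using A by blast
    qed
  qed
  have c0: "(i, c0) \<notin> A"
  proof
    assume i: "(i, c0) \<in> A"
    obtain c' where c': "(i, c') \<in> A" "c' \<noteq> c0" using other by blast
    have "nonisolated A (i, c')" by (rule nonisolatedI[OF i]) (use c' in auto)
    moreover have "\<not> two_stars (A - {(i, c')})"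
      by (rule not_two_stars_path[of i c0 _ r0 j]) (use i c' e r0j in auto)
    ultimately show False using H c' by blast
  qed
  obtain c' where c': "(i, c') \<in> A" "c' \<noteq> c" using other by blast
  have "c'' = c \<or> c'' = c'" if "(i, c'') \<in> A" for c''
  proof (rule ccontr)
    assume n: "\<not> ?thesis"
    have "nonisolated A (i, c'')" by (rule nonisolatedI[OF c]) (use n in auto)
    moreover have "\<not> two_stars (A - {(i, c'')})"
      by (rule not_two_stars_rows[of i c _ c' r0 j c0]) (use c c' n e r0j in auto)
    ultimately show False using H that by blast
  qed
  then have "A = {(i, c), (i, c'), (r0, j), (r0, c0)}" using shape c c' e r0j by fast
  moreover have "distinct [c, c', j, c0]" using c c' c0 cj e star[OF c'(1)] by auto
  ultimately show ?thesis unfolding two_row_pairs_def using e(2)[symmetric] by blast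
qed

text \<open>If deleting a nonisolated cell \<open>(r0, c0)\<close> leaves two stars in row
  \<open>i\<close> and column \<open>j\<close>, then this cell lies on both lines or on neither, as
  \<open>A\<close> is not two stars. On both, a cell of row \<open>i\<close> can be deleted instead.
  On neither, a neighbor of the cell leads to the exceptional sets.\<close>

lemma removable_cell:
  assumes A: "\<not> two_stars A" and nm: "\<not> (inj_on fst A \<and> inj_on snd A)"
  shows "(\<exists>r c. (r, c) \<in> A \<and> nonisolated A (r, c) \<and> \<not> two_stars (A - {(r, c)})) \<or>
    two_row_pairs A \<or> two_row_pairs (A\<inverse>)"
proof (rule ccontr)
  assume "\<not> ?thesis"
  then have H: "\<And>r c. \<lbrakk>(r, c) \<in> A; nonisolated A (r, c)\<rbrakk> \<Longrightarrow> two_stars (A - {(r, c)})"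
    and np: "\<not> two_row_pairs A" "\<not> two_row_pairs (A\<inverse>)" by blast+
  obtain r0 c0 where e: "(r0, c0) \<in> A" "nonisolated A (r0, c0)"
    using nm unfolding inj_on_def nonisolated_def by (metis prod.collapse)
  obtain i j c r where star: "\<And>a b. (a, b) \<in> A - {(r0, c0)} \<Longrightarrow> (a = i) \<noteq> (b = j)"
    and c: "(i, c) \<in> A - {(r0, c0)}" and r: "(r, j) \<in> A - {(r0, c0)}"
    using two_starsD[OF H[OF e]] by blast
  have cj: "c \<noteq> j" using star[OF c] by auto
  have ri: "r \<noteq> i" using star[OF r] by auto
  have iff: "r0 = i \<longleftrightarrow> c0 = j"
  proof (rule ccontr)
    assume "(r0 = i) \<noteq> (c0 = j)"
    then have "two_stars A" by (intro two_starsI[of A i j c r]) (use star c r in fast)+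
    then show False using A by blast
  qed
  show False
  proof (cases "r0 = i")
    case True
    then have c0: "c0 = j" using iff by simp
    have "nonisolated A (i, c)" by (rule nonisolatedI[OF e(1)]) (use True c0 cj in auto)
    moreover have "\<not> two_stars (A - {(i, c)})"
    proof (cases "\<exists>c'. (i, c') \<in> A \<and> c' \<noteq> c \<and> c' \<noteq> j")
      case True
      then obtain c' where "(i, c') \<in> A" "c' \<noteq> c" "c' \<noteq> j" by blast
      then show ?thesis
        by (intro not_two_stars_path[of r j _ i c']) (use r e c0 \<open>r0 = i\<close> cj ri in auto)
    next
      case False
      then show ?thesis
        by (intro not_two_stars_column[of _ j]) (use star c0 in fast)
    qed
    ultimately show False using H c by blast
  next
    case False
    then have c0: "c0 \<noteq> j" using iff by simp
    \<comment> \<open>A neighbor in row \<open>r0\<close> is outside row \<open>i\<close>, hence in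
      column \<open>j\<close>; a neighbor in column \<open>c0\<close> is likewise in row
      \<open>i\<close>. The second case is the transpose of the first.\<close>
    obtain a b where ab: "(a, b) \<in> A" "(a, b) \<noteq> (r0, c0)" "a = r0 \<or> b = c0"
      using e(2) unfolding nonisolated_def by fastforce
    then consider "(r0, j) \<in> A" | "(i, c0) \<in> A" using star[of a b] False c0 by auto
    then show False
    proof cases
      case 1
      have "two_row_pairs A"
        using two_row_pairs_critical[OF A H _ e(1) False c0 1] star c by blast
      then show False using np by blast
    next
      case 2
      have H': "two_stars (A\<inverse> - {(s, d)})" if "(s, d) \<in> A\<inverse>" "nonisolated (A\<inverse>) (s, d)" for s d
      proof -
        have "two_stars (A - {(d, s)})" by (rule H) (use that in \<open>simp_all add: nonisolated_converse\<close>)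
        then have "two_stars ((A - {(d, s)})\<inverse>)" by (simp only: two_stars_converse)
        moreover have "(A - {(d, s)})\<inverse> = A\<inverse> - {(s, d)}" by blast
        ultimately show ?thesis by simp
      qed
      have star': "(a = j) \<noteq> (b = i)" if "(a, b) \<in> A\<inverse>" "(a, b) \<noteq> (c0, r0)" for a b
        using star[of b a] that by fast
      have A': "\<not> two_stars (A\<inverse>)" using A two_stars_converse by blast
      have mem: "(c0, r0) \<in> A\<inverse>" "(c0, i) \<in> A\<inverse>" "(j, r) \<in> A\<inverse>" using e 2 r by auto
      have "two_row_pairs (A\<inverse>)"
        by (rule two_row_pairs_critical[OF A' H' star' mem(1) c0 False mem(2,3)])
      then show False using np by blast
    qed
  qed
qed

section \<open>Rainbow sets by induction on the order\<close>

lemma rainbowD: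
  "\<lbrakk>rainbow L A; (i, j) \<in> A; (i', j') \<in> A; L i j = L i' j'\<rbrakk> \<Longrightarrow> i = i' \<and> j = j'"
  unfolding rainbow_def inj_on_def by fastforce

lemma latin_flip: "latin R C S L \<Longrightarrow> latin C R S (\<lambda>j i. L i j)"
  unfolding latin_def by blast

lemma rainbow_flip: "rainbow L (A\<inverse>) \<Longrightarrow> rainbow (\<lambda>i j. L j i) A"
  by (rule rainbowI) (auto dest: rainbowD)

text \<open>Deleting any cell of such a set leaves a pair in one row and a single cell elsewhere,
  which are two stars. Hence this case is settled directly, in the cyclic square of order 4.\<close>

lemma rainbow_two_row_pairs:
  assumes "finite R" "finite C" "card R = n" "card C = n" "A \<subseteq> R \<times> C" "card A = n" "two_row_pairs A"
  shows "\<exists>L. latin R C {..<n} L \<and> rainbow L A"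
proof -
  obtain a b x y u v where ab: "a \<noteq> b" and d: "distinct [x, y, u, v]"
    and A: "A = {(a, x), (a, y), (b, u), (b, v)}"
    using assms(7) unfolding two_row_pairs_def by blast
  have n: "n = 4" using assms(6) d ab unfolding A by auto
  have "card {x, y, u, v} = card C" using d assms(4) n by simp
  then have C: "C = {x, y, u, v}"
    using assms(2,5) A card_subset_eq[of C "{x, y, u, v}"] by auto
  have "card (R - {a, b}) = 2" using assms(1,3,5) A ab n by (simp add: card_Diff_subset)
  then obtain p q where pq: "R - {a, b} = {p, q}" "p \<noteq> q" by (auto simp: card_2_iff)
  then have R: "R = {a, b, p, q}" "distinct [a, b, p, q]" using assms(5) A ab by auto
  \<comment> \<open>With these numberings the four cells carry the sums 0, 2, 3 and 1 modulo
    4.\<close>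
  define \<rho> where "\<rho> = (\<lambda>_. 0::nat)(b := 2, p := 1, q := 3)"
  define \<gamma> where "\<gamma> = (\<lambda>_. 0::nat)(y := 2, u := 1, v := 3)"
  have four: "{..<n} = {0, 1, 2, 3}" using n by auto
  have \<rho>: "bij_betw \<rho> R {..<n}" and \<gamma>: "bij_betw \<gamma> C {..<n}"
    using R d unfolding four C by (auto simp: bij_betw_def inj_on_def \<rho>_def \<gamma>_def)
  have "rainbow (\<lambda>i j. (\<rho> i + \<gamma> j) mod n) A"
    unfolding rainbow_def inj_on_def A using n d R(2) by (auto simp: \<rho>_def \<gamma>_def)
  then show ?thesis using latin_transport[OF cyclic_latin \<rho> \<gamma>] by blast
qed

text \<open>Order the lines so that \<open>(r, c)\<close> is on the antidiagonal and the rest of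
  \<open>A\<close> above it. The rest then avoids the last row and column and is rainbow in a square
  of order \<open>m\<close>. Smetaniuk's extension keeps its symbols, all below \<open>m\<close>,
  and puts \<open>m\<close> on \<open>(r, c)\<close>.\<close>

lemma rainbow_extend:
  assumes "finite R" "finite C" "card R = Suc m" "card C = Suc m" "A \<subseteq> R \<times> C" "card A = Suc m"
    and e: "(r, c) \<in> A" and ni: "nonisolated A (r, c)"
    and IH: "\<And>R' C'. \<lbrakk>finite R'; finite C'; card R' = m; card C' = m; A - {(r, c)} \<subseteq> R' \<times> C'\<rbrakk>
      \<Longrightarrow> \<exists>L. latin R' C' {..<m} L \<and> rainbow L (A - {(r, c)})"
  shows "\<exists>L. latin R C {..<Suc m} L \<and> rainbow L A"
proof -
  obtain \<rho> \<gamma> where \<rho>: "bij_betw \<rho> R {..<Suc m}" and \<gamma>: "bij_betw \<gamma> C {..<Suc m}"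
    and rc: "\<rho> r + \<gamma> c = m" and small: "\<And>i j. (i, j) \<in> A - {(r, c)} \<Longrightarrow> \<rho> i + \<gamma> j < m"
    using staircase_with_corner[OF assms(1-6) e ni] by fastforce
  define R' where "R' = {i \<in> R. \<rho> i < m}"
  define C' where "C' = {j \<in> C. \<gamma> j < m}"
  have \<rho>': "bij_betw \<rho> R' {..<m}" and \<gamma>': "bij_betw \<gamma> C' {..<m}"
    using \<rho> \<gamma> unfolding R'_def C'_def bij_betw_def
    by (auto simp: inj_on_def lessThan_Suc image_iff)
  have "card R' = m" "card C' = m" using bij_betw_same_card[OF \<rho>'] bij_betw_same_card[OF \<gamma>'] by auto
  moreover have sub: "A - {(r, c)} \<subseteq> R' \<times> C'"
    using assms(5) small unfolding R'_def C'_def by fastforce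
  ultimately obtain L where L: "latin R' C' {..<m} L" "rainbow L (A - {(r, c)})"
    using IH[of R' C'] assms(1,2) unfolding R'_def C'_def by auto
  have "latin {..<m} {..<m} {..<m} (\<lambda>x y. L (inv_into R' \<rho> x) (inv_into C' \<gamma> y))"
    by (rule latin_transport[OF L(1) bij_betw_inv_into[OF \<rho>'] bij_betw_inv_into[OF \<gamma>']])
  from smetaniuk[OF this] obtain K where K: "latin {..m} {..m} {..m} K"
    and kept: "\<And>x y. x \<le> m \<Longrightarrow> y \<le> m \<Longrightarrow> x + y < m \<Longrightarrow> K x y = L (inv_into R' \<rho> x) (inv_into C' \<gamma> y)"
    and diag: "\<And>x y. x \<le> m \<Longrightarrow> y \<le> m \<Longrightarrow> x + y = m \<Longrightarrow> K x y = m" by blast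
  have latin: "latin R C {..<Suc m} (\<lambda>i j. K (\<rho> i) (\<gamma> j))"
    using latin_transport[OF K[folded lessThan_Suc_atMost] \<rho> \<gamma>] .
  have corner: "K (\<rho> r) (\<gamma> c) = m" using diag rc by simp
  have old: "K (\<rho> i) (\<gamma> j) = L i j" "L i j < m" if "(i, j) \<in> A - {(r, c)}" for i j
  proof -
    have ij: "i \<in> R'" "j \<in> C'" using that sub by auto
    then have "inv_into R' \<rho> (\<rho> i) = i" "inv_into C' \<gamma> (\<gamma> j) = j"
      using \<rho>' \<gamma>' unfolding bij_betw_def by auto
    then show "K (\<rho> i) (\<gamma> j) = L i j" using kept[of "\<rho> i" "\<gamma> j"] small[OF that] by simp
    show "L i j < m" using L(1) ij bij_betwE unfolding latin_def by blast
  qed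
  have "rainbow (\<lambda>i j. K (\<rho> i) (\<gamma> j)) A"
  proof (rule rainbowI)
    fix i j i' j' assume a: "(i, j) \<in> A" "(i', j') \<in> A" "K (\<rho> i) (\<gamma> j) = K (\<rho> i') (\<gamma> j')"
    consider "(i, j) = (r, c)" "(i', j') = (r, c)"
      | "(i, j) \<in> A - {(r, c)}" "(i', j') = (r, c)" | "(i, j) = (r, c)" "(i', j') \<in> A - {(r, c)}"
      | "(i, j) \<in> A - {(r, c)}" "(i', j') \<in> A - {(r, c)}"
      using a by blast
    then show "i = i' \<and> j = j'"
    proof cases
      case 1
      then show ?thesis by simp
    next
      case 2
      then show ?thesis using old[OF 2(1)] corner a(3) by simp
    next
      case 3
      then show ?thesis using old[OF 3(2)] corner a(3) by simp
    next
      case 4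
      then have "L i j = L i' j'" using old[OF 4(1)] old[OF 4(2)] a(3) by simp
      then show ?thesis using rainbowD[OF L(2) 4] by simp
    qed
  qed
  then show ?thesis using latin by blast
qed

text \<open>Either \<open>A\<close> is a transversal, or a nonisolated cell can be removed and the
  induction hypothesis applies, or \<open>A\<close> is exceptional up to transposition.\<close>

theorem rainbow_latin_square:
  assumes "finite R" "finite C" "card R = n" "card C = n" "A \<subseteq> R \<times> C" "card A = n" "\<not> two_stars A"
  shows "\<exists>L. latin R C {..<n} L \<and> rainbow L A"
  using assms
proof (induction n arbitrary: R C A)
  case 0
  then have "A = {}" using finite_subset[OF "0.prems"(5)] by auto
  then show ?case using 0 by (intro rainbow_matching) auto
next
  case (Suc m)
  show ?case
  proof (cases "inj_on fst A \<and> inj_on snd A")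
    case True
    \<comment> \<open>Two cells in different rows and columns are two stars, which excludes the
      order without a transversal.\<close>
    have "Suc m \<noteq> 2"
    proof
      assume "Suc m = 2"
      then obtain p q where pq: "A = {p, q}" "p \<noteq> q" 
        using Suc.prems(6) card_2_iff by metis
      then have "fst p \<noteq> fst q" "snd p \<noteq> snd q" using True by (auto simp: inj_on_def)
      then have "two_stars A" unfolding two_stars_def pq
        by (intro exI[of _ "fst p"] exI[of _ "snd q"]) auto
      then show False using Suc.prems(7) by blast
    qed
    then show ?thesis using rainbow_matching Suc.prems True by blast
  next
    case False
    from removable_cell[OF Suc.prems(7) False]
    consider (cell) r c where "(r, c) \<in> A" "nonisolated A (r, c)" "\<not> two_stars (A - {(r, c)})"
      | (rows) "two_row_pairs A" | (columns) "two_row_pairs (A\<inverse>)" by blast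
    then show ?thesis
    proof cases
      case cell
      have "card (A - {(r, c)}) = m" using cell(1) Suc.prems(6) by simp
      then show ?thesis
        using rainbow_extend[OF Suc.prems(1-6) cell(1,2)] Suc.IH cell(3) by blast
    next
      case rows
      then show ?thesis using rainbow_two_row_pairs Suc.prems by blast
    next
      case columns
      have "A\<inverse> \<subseteq> C \<times> R" "card (A\<inverse>) = Suc m" using Suc.prems by (auto simp: card_inverse)
      then obtain L where "latin C R {..<Suc m} L" "rainbow L (A\<inverse>)"
        using rainbow_two_row_pairs[of C R "Suc m" "A\<inverse>"] columns Suc.prems by blast
      then show ?thesis using latin_flip rainbow_flip by blast
    qed
  qed
qed

section \<open>Balanced diagonals\<close>

lemma finite_cells: "finite (cells n)"
  unfolding cells_def by simp

text \<open>Choose a cell of color \<open>k\<close> in each diagonal. The diagonal through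
  \<open>(i, j)\<close> has no other cell in row \<open>i\<close> or column \<open>j\<close>, so the
  cell chosen there lies on both lines or on neither, and the chosen set is not improper for this
  pair.\<close>

lemma proper_of_balanced_partition:
  assumes P: "partition_on (cells n) P" "card P = n" "\<And>D. D \<in> P \<Longrightarrow> diagonal n D \<and> balanced M D"
  shows "\<exists>A. A \<subseteq> cells n \<and> card A = n \<and> proper n A \<and> (\<forall>c\<in>A. M c = k)"
proof -
  have "\<forall>D\<in>P. \<exists>c. c \<in> D \<and> M c = k" using P(3) unfolding balanced_def by blast
  then obtain f where f: "\<And>D. D \<in> P \<Longrightarrow> f D \<in> D \<and> M (f D) = k" by metis
  have inj: "inj_on f P"
  proof (rule inj_onI)
    fix D E assume "D \<in> P" "E \<in> P" "f D = f E"
    then have "f D \<in> D \<inter> E" using f by force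
    then show "D = E" using partition_onD2[OF P(1)] \<open>D \<in> P\<close> \<open>E \<in> P\<close> unfolding disjoint_def by blast
  qed
  have "proper n (f ` P)"
  proof
    assume "improper n (f ` P)"
    then obtain i j where ij: "i \<in> {1..n}" "j \<in> {1..n}" and cross: "\<And>c. c \<in> f ` P \<Longrightarrow> (fst c = i) \<noteq> (snd c = j)"
      unfolding improper_def by blast
    then have "(i, j) \<in> \<Union>P" using partition_onD1[OF P(1)] unfolding cells_def by auto
    then obtain D where D: "D \<in> P" "(i, j) \<in> D" by blast
    have "(fst (f D) = i) \<noteq> (snd (f D) = j)" using cross D by blast
    moreover have "f D \<noteq> (i, j) \<longrightarrow> fst (f D) \<noteq> i \<and> snd (f D) \<noteq> j"
      using P(3)[OF D(1)] f[OF D(1)] D(2) unfolding diagonal_def by force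
    ultimately show False by auto
  qed
  moreover have "f ` P \<subseteq> cells n" using f partition_onD1[OF P(1)] by blast
  moreover have "card (f ` P) = n" using inj P(2) by (simp add: card_image)
  ultimately show ?thesis using f by blast
qed

section \<open>Balanced partitions from rainbow sets\<close>

lemma not_two_stars_if_proper:
  assumes "A \<subseteq> cells n" "proper n A"
  shows "\<not> two_stars A"
proof
  assume "two_stars A"
  then obtain i j c r where *: "\<And>a b. (a, b) \<in> A \<Longrightarrow> (a = i) \<noteq> (b = j)" "(i, c) \<in> A" "(r, j) \<in> A"
    using two_starsD by blast
  then have "i \<in> {1..n}" "j \<in> {1..n}" using assms(1) unfolding cells_def by auto
  then have "improper n A" unfolding improper_def using *(1) by (metis prod.collapse)
  then show False using assms(2) by blast
qed

text \<open>The symbol classes are the parts. Balance has to be supplied only for classes already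
  known to be diagonals, a fact established here.\<close>

lemma balanced_partition_of_latin:
  assumes L: "latin {1..n} {1..n} {..<n} L" and "n \<ge> 1"
    and bal: "\<And>s. \<lbrakk>s < n; diagonal n {c \<in> cells n. case_prod L c = s}\<rbrakk> \<Longrightarrow> balanced M {c \<in> cells n. case_prod L c = s}"
  shows "\<exists>P. partition_on (cells n) P \<and> card P = n \<and> (\<forall>D\<in>P. diagonal n D \<and> balanced M D)"
proof -
  define D where "D = (\<lambda>s. {c \<in> cells n. case_prod L c = s})"
  have rows: "bij_betw (L i) {1..n} {..<n}" if "i \<in> {1..n}" for i using L that unfolding latin_def by blast
  have columns: "bij_betw (\<lambda>i. L i j) {1..n} {..<n}" if "j \<in> {1..n}" for j using L that unfolding latin_def by blast
  have lt: "case_prod L c < n" if "c \<in> cells n" for c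
    using that rows bij_betwE unfolding cells_def by fastforce
  have row_inj: "b = b'" if "(a, b) \<in> D s" "(a, b') \<in> D s" for a b b' s
  proof -
    have "a \<in> {1..n}" "b \<in> {1..n}" "b' \<in> {1..n}" "L a b = L a b'" using that unfolding D_def cells_def by auto
    then show ?thesis using rows unfolding bij_betw_def inj_on_def by blast
  qed
  have column_inj: "a = a'" if "(a, b) \<in> D s" "(a', b) \<in> D s" for a a' b s
  proof -
    have "b \<in> {1..n}" "a \<in> {1..n}" "a' \<in> {1..n}" "L a b = L a' b" using that unfolding D_def cells_def by auto
    then show ?thesis using columns unfolding bij_betw_def inj_on_def by blast
  qed
  have ex: "\<exists>b. (a, b) \<in> D s" if "a \<in> {1..n}" "s < n" for a s
  proof -
    have "s \<in> L a ` {1..n}" using rows[OF that(1)] that(2) unfolding bij_betw_def by simp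
    then show ?thesis using that(1) unfolding D_def cells_def by auto
  qed
  have diag: "diagonal n (D s)" if s: "s < n" for s
    unfolding diagonal_def
  proof (intro conjI ballI impI)
    show "D s \<subseteq> cells n" unfolding D_def by blast
    have "inj_on fst (D s)" using row_inj by (intro inj_onI) (metis prod.collapse)
    moreover have "fst ` D s = {1..n}" using ex[OF _ s] unfolding D_def cells_def by force
    ultimately show "card (D s) = n" using card_image by fastforce
  next
    fix c d assume "c \<in> D s" "d \<in> D s" "c \<noteq> d"
    then show "fst c \<noteq> fst d" "snd c \<noteq> snd d" using row_inj column_inj by (metis prod.collapse)+
  qed
  have ne: "D s \<noteq> {}" if "s < n" for s using ex[of 1 s] that \<open>n \<ge> 1\<close> by auto
  have "inj_on D {..<n}"
  proof (rule inj_onI)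
    fix s t assume "s \<in> {..<n}" "t \<in> {..<n}" "D s = D t"
    moreover from this obtain c where "c \<in> D s" using ne by fastforce
    ultimately have "c \<in> D s" "c \<in> D t" by auto
    then show "s = t" unfolding D_def by auto
  qed
  then have "card (D ` {..<n}) = n" by (simp add: card_image)
  moreover have "partition_on (cells n) (D ` {..<n})"
  proof (rule partition_onI)
    show "\<Union>(D ` {..<n}) = cells n"
    proof
      show "\<Union>(D ` {..<n}) \<subseteq> cells n" unfolding D_def by blast
      show "cells n \<subseteq> \<Union>(D ` {..<n})"
      proof
        fix c assume "c \<in> cells n"
        then have "c \<in> D (case_prod L c)" "case_prod L c \<in> {..<n}" using lt unfolding D_def by simp_all
        then show "c \<in> \<Union>(D ` {..<n})" by blast
      qed
    qed
    show "{} \<notin> D ` {..<n}" using ne by auto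
    show "disjnt p q" if "p \<in> D ` {..<n}" "q \<in> D ` {..<n}" "p \<noteq> q" for p q
    proof -
      obtain s t where st: "p = D s" "q = D t" using \<open>p \<in> D ` {..<n}\<close> \<open>q \<in> D ` {..<n}\<close> by blast
      then have "s \<noteq> t" using \<open>p \<noteq> q\<close> by blast
      then show ?thesis unfolding st D_def disjnt_def by auto
    qed
  qed
  moreover have "\<forall>E\<in>D ` {..<n}. diagonal n E \<and> balanced M E"
  proof
    fix E assume "E \<in> D ` {..<n}"
    then obtain s where s: "s < n" "E = D s" by auto
    show "diagonal n E \<and> balanced M E"
      using diag[OF s(1)] bal[OF s(1) diag[OF s(1), unfolded D_def]] s(2) unfolding D_def by simp
  qed
  ultimately show ?thesis by blast
qed

lemma color_cases: "(k :: color) \<noteq> k' \<Longrightarrow> l = k \<or> l = k'"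
  by (cases k; cases k'; cases l) auto

text \<open>The \<open>n\<close> cells of \<open>A\<close> carry all \<open>n\<close> symbols, so
  each class meets \<open>A\<close> exactly once. This gives it a cell of color \<open>k\<close>,
  and \<open>other\<close> gives it a cell of the other color.\<close>

lemma balanced_partition_of_rainbow:
  assumes "n \<ge> 1" "A \<subseteq> cells n" "card A = n" "\<not> two_stars A" "\<And>c. c \<in> A \<Longrightarrow> M c = k"
    and other: "\<And>D. \<lbrakk>diagonal n D; \<forall>c\<in>D \<inter> A. \<forall>d\<in>D \<inter> A. c = d\<rbrakk> \<Longrightarrow> \<exists>c\<in>D. M c \<noteq> k"
  shows "\<exists>P. partition_on (cells n) P \<and> card P = n \<and> (\<forall>D\<in>P. diagonal n D \<and> balanced M D)"
proof -
  obtain L where L: "latin {1..n} {1..n} {..<n} L" and A: "rainbow L A"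
    using rainbow_latin_square[of "{1..n}" "{1..n}" n A] assms(2-4) unfolding cells_def by auto
  have "case_prod L ` A \<subseteq> {..<n}"
  proof (clarsimp)
    fix a b assume "(a, b) \<in> A"
    then have "a \<in> {1..n}" "b \<in> {1..n}" using assms(2) unfolding cells_def by auto
    then have "L a b \<in> {..<n}" using L bij_betwE unfolding latin_def by blast
    then show "L a b < n" by simp
  qed
  moreover have "card (case_prod L ` A) = n"
    using A assms(3) unfolding rainbow_def by (simp add: card_image)
  ultimately have img: "case_prod L ` A = {..<n}" by (simp add: card_subset_eq)
  show ?thesis
  proof (rule balanced_partition_of_latin[OF L \<open>n \<ge> 1\<close>])
    fix s assume s: "s < n" and diag: "diagonal n {c \<in> cells n. case_prod L c = s}" (is "diagonal n ?D")
    have "s \<in> case_prod L ` A" using img s by simp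
    then obtain a where a: "a \<in> A" "case_prod L a = s" by blast
    have "\<forall>c\<in>?D \<inter> A. \<forall>d\<in>?D \<inter> A. c = d"
      using inj_onD[OF A[unfolded rainbow_def]] by simp
    then obtain d where d: "d \<in> ?D" "M d \<noteq> k" using other[OF diag] by blast
    have "a \<in> ?D" "M a = k" using a assms(2,5) by auto
    then have "\<exists>c\<in>?D. M c = l" for l using d color_cases[OF d(2), of l] by blast
    then show "balanced M ?D" unfolding balanced_def by blast
  qed
qed

text \<open>A diagonal of color \<open>k\<close> with at most one cell in \<open>A\<close> would,
  together with \<open>A\<close>, make up at least \<open>2 * n - 1\<close> cells of that
  color.\<close>

lemma balanced_partition_of_scarce_color:
  assumes "n \<ge> 1" "A \<subseteq> cells n" "card A = n" "\<not> two_stars A" "\<And>c. c \<in> A \<Longrightarrow> M c = k"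
    and few: "card {c \<in> cells n. M c = k} < 2 * n - 1"
  shows "\<exists>P. partition_on (cells n) P \<and> card P = n \<and> (\<forall>D\<in>P. diagonal n D \<and> balanced M D)"
proof (rule balanced_partition_of_rainbow[where k = k, OF assms(1-4)])
  fix D assume D: "diagonal n D" and one: "\<forall>c\<in>D \<inter> A. \<forall>d\<in>D \<inter> A. c = d"
  have finDA: "finite D" "finite A" using D assms(2) finite_subset[OF _ finite_cells] unfolding diagonal_def by blast+
  show "\<exists>c\<in>D. M c \<noteq> k"
  proof (rule ccontr)
    assume "\<not> ?thesis"
    then have "D \<union> A \<subseteq> {c \<in> cells n. M c = k}" using D assms(2,5) unfolding diagonal_def by auto
    then have "card (D \<union> A) \<le> card {c \<in> cells n. M c = k}" 
      by (intro card_mono) (simp_all add: finite_cells)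
    moreover have "card (D \<inter> A) \<le> 1" using one finDA by (auto simp: card_le_Suc0_iff_eq)
    moreover have "card (D \<union> A) + card (D \<inter> A) = 2 * n"
      using card_Un_Int[OF finDA] D assms(3) unfolding diagonal_def by simp
    ultimately show False using few by linarith
  qed
qed (use assms(5) in auto)

text \<open>A diagonal has a cell in row \<open>p\<close> and one in row \<open>q\<close>. If both
  had color \<open>k\<close>, both would belong to \<open>A\<close>.\<close>

lemma balanced_partition_of_two_rows:
  assumes "n \<ge> 1" "A \<subseteq> cells n" "card A = n" "\<not> two_stars A" "\<And>c. c \<in> A \<Longrightarrow> M c = k"
    and pq: "p \<in> {1..n}" "q \<in> {1..n}" "p \<noteq> q"
    and sub: "{c \<in> cells n. M c = k \<and> (fst c = p \<or> fst c = q)} \<subseteq> A"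
  shows "\<exists>P. partition_on (cells n) P \<and> card P = n \<and> (\<forall>D\<in>P. diagonal n D \<and> balanced M D)"
proof (rule balanced_partition_of_rainbow[where k = k, OF assms(1-4)])
  fix D assume D: "diagonal n D" and one: "\<forall>c\<in>D \<inter> A. \<forall>d\<in>D \<inter> A. c = d"
  have inj: "inj_on fst D" and "card D = n" and "D \<subseteq> cells n"
    using D unfolding diagonal_def inj_on_def by blast+
  then have sub_rows: "fst ` D \<subseteq> {1..n}" unfolding cells_def by auto
  have "card (fst ` D) = card {1..n}" using card_image[OF inj] \<open>card D = n\<close> by simp
  then have "fst ` D = {1..n}" by (rule card_subset_eq[OF finite_atLeastAtMost sub_rows])
  then have "p \<in> fst ` D" "q \<in> fst ` D" using pq by simp_all
  then obtain c d where cd: "c \<in> D" "fst c = p" "d \<in> D" "fst d = q" by blast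
  have "c \<noteq> d" using cd pq(3) by auto
  then have "c \<notin> A \<or> d \<notin> A" using one cd(1,3) by blast
  moreover have "x \<in> A" if "x \<in> D" "M x = k" "fst x = p \<or> fst x = q" for x
    using sub that \<open>D \<subseteq> cells n\<close> by blast
  ultimately show "\<exists>c\<in>D. M c \<noteq> k" using cd by metis
qed (use assms(5) in auto)

text \<open>The set \<open>X\<close> guards every larger set against being two stars, so it may be
  completed freely. Some row \<open>i\<close> has two cells of \<open>T\<close>. If another row also
  has two, take both pairs; otherwise row \<open>i\<close> is full and a cell of another row yields
  a path.\<close>

lemma proper_kernel:
  assumes "n \<ge> 2" "T \<subseteq> cells n" "card T \<ge> 2 * n - 1"
  shows "\<exists>X\<subseteq>T. card X \<le> 4 \<and> (\<forall>A. X \<subseteq> A \<longrightarrow> \<not> two_stars A)"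
proof -
  have fin: "finite T" using assms(2) finite_cells by (rule finite_subset)
  have fstT: "fst ` T \<subseteq> {1..n}" "snd ` T \<subseteq> {1..n}" using assms(2) unfolding cells_def by auto
  have "\<not> inj_on fst T"
  proof
    assume "inj_on fst T"
    then have "card T \<le> n" using card_inj_on_le[OF _ fstT(1)] by simp
    then show False using assms by simp
  qed
  then obtain i x y where i: "(i, x) \<in> T" "(i, y) \<in> T" "x \<noteq> y" unfolding inj_on_def by fastforce
  define U where "U = {c \<in> T. fst c \<noteq> i}"
  show ?thesis
  proof (cases "inj_on fst U")
    case False
    then obtain b u v where b: "(b, u) \<in> U" "(b, v) \<in> U" "u \<noteq> v" unfolding inj_on_def by fastforce
    then have bi: "i \<noteq> b" unfolding U_def by auto
    have "\<not> two_stars A" if "{(i, x), (i, y), (b, u), (b, v)} \<subseteq> A" for A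
      using not_two_stars_rows[of i x A y b u v] that i b bi by blast
    moreover have "card {(i, x), (i, y), (b, u), (b, v)} \<le> 4"
      by (simp add: card_insert_if)
    moreover have "{(i, x), (i, y), (b, u), (b, v)} \<subseteq> T" using i b unfolding U_def by auto
    ultimately show ?thesis by blast
  next
    case True
    have ifull: "i \<in> {1..n}" using i fstT by force
    have "fst ` U \<subseteq> {1..n} - {i}" using fstT unfolding U_def by auto
    then have "card U \<le> card ({1..n} - {i})" using card_inj_on_le[OF True] by blast
    then have cU: "card U \<le> n - 1" using ifull by simp
    have sub: "T - U \<subseteq> {i} \<times> {1..n}" using fstT unfolding U_def by force
    have "card T = card U + card (T - U)"
      using fin card_Diff_subset[of U T] card_mono[OF fin, of U] finite_subset[of U T] unfolding U_def by auto
    moreover have "card (T - U) \<le> card ({i} \<times> {1..n})" by (rule card_mono[OF _ sub]) simp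
    then have "card (T - U) \<le> n" by (simp add: card_cartesian_product)
    \<comment> \<open>Row \<open>i\<close> has at most \<open>n\<close> cells and the other rows
      together at most \<open>n - 1\<close>, so a total of \<open>2 * n - 1\<close> leaves no
      slack.\<close>
    ultimately have "card (T - U) = n" "card U \<noteq> 0" using cU assms by linarith+
    then have full: "T - U = {i} \<times> {1..n}" and "U \<noteq> {}"
      using card_subset_eq[OF _ sub] by (auto simp: card_cartesian_product)
    then obtain r c where rc: "(r, c) \<in> U" by auto
    then have r: "r \<noteq> i" "(r, c) \<in> T" "c \<in> {1..n}" using fstT unfolding U_def by force+
    have ic: "(i, c) \<in> T" using full r by blast
    obtain z where z: "(i, z) \<in> T" "c \<noteq> z" using i by metis
    have "\<not> two_stars A" if "{(r, c), (i, c), (i, z)} \<subseteq> A" for A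
      using not_two_stars_path[of r c A i z] that r z by blast
    moreover have "card {(r, c), (i, c), (i, z)} \<le> 4"
      by (simp add: card_insert_if)
    moreover have "{(r, c), (i, c), (i, z)} \<subseteq> T" using r ic z by auto
    ultimately show ?thesis by blast
  qed
qed

lemma balanced_partition_of_abundant_colors:
  assumes n: "n \<ge> 6" and many: "\<And>k. card {c \<in> cells n. M c = k} \<ge> 2 * n - 1"
  shows "\<exists>P. partition_on (cells n) P \<and> card P = n \<and> (\<forall>D\<in>P. diagonal n D \<and> balanced M D)"
proof -
  define S where "S = (\<lambda>k i. {c \<in> cells n. M c = k \<and> fst c = i})"
  have finS: "finite (S k i)" for k i unfolding S_def by (simp add: finite_cells)
  have sum: "card (S Red i) + card (S Blue i) = n" if "i \<in> {1..n}" for i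
  proof -
    have "M c = Red \<or> M c = Blue" for c by (cases "M c") simp_all
    then have "S Red i \<union> S Blue i = {c \<in> cells n. fst c = i}" unfolding S_def by blast
    also have "\<dots> = {i} \<times> {1..n}" using that unfolding cells_def by auto
    finally have "S Red i \<union> S Blue i = {i} \<times> {1..n}" .
    moreover have "S Red i \<inter> S Blue i = {}" unfolding S_def by auto
    ultimately show ?thesis using card_Un_disjoint[OF finS finS, of Red i Blue i] by (simp add: card_cartesian_product)
  qed
  \<comment> \<open>Any set of at most \<open>n\<close> cells of color \<open>k\<close> that
    contains all such cells in two rows and excludes two stars grows to the required
    \<open>A\<close>, as color \<open>k\<close> is abundant.\<close>
  have extend: ?thesis
    if "p \<in> {1..n}" "q \<in> {1..n}" "p \<noteq> q" and X: "X \<subseteq> {c \<in> cells n. M c = k}" "card (S k p \<union> S k q \<union> X) \<le> n"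
      "\<And>A. S k p \<union> S k q \<union> X \<subseteq> A \<Longrightarrow> \<not> two_stars A" for p q k X
  proof -
    have "S k p \<union> S k q \<union> X \<subseteq> {c \<in> cells n. M c = k}" using X unfolding S_def by auto
    moreover have "n \<le> card {c \<in> cells n. M c = k}" using many[of k] n by simp
    moreover have "finite {c \<in> cells n. M c = k}" by (simp add: finite_cells)
    ultimately obtain A where A: "S k p \<union> S k q \<union> X \<subseteq> A" "A \<subseteq> {c \<in> cells n. M c = k}" "card A = n"
      using exists_subset_between[OF X(2)] by blast
    show ?thesis
    proof (rule balanced_partition_of_two_rows[OF _ _ A(3) X(3)[OF A(1)] _ that(1-3)])
      show "1 \<le> n" using n by simp
      show "A \<subseteq> cells n" using A(2) by blast
      show "M c = k" if "c \<in> A" for c using A(2) that by blast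
      show "{c \<in> cells n. M c = k \<and> (fst c = p \<or> fst c = q)} \<subseteq> A" using A(1) unfolding S_def by blast
    qed
  qed
  \<comment> \<open>Three types of rows: at most one red cell, at most one blue cell, at least two
    of each. Two of the first four rows have the same type.\<close>
  define t where "t = (\<lambda>i. if card (S Red i) \<le> 1 then 0 else if card (S Blue i) \<le> 1 then 1 else (2::nat))"
  have "t ` {1..4} \<subseteq> {..<3}" unfolding t_def by auto
  then have "card (t ` {1..4}) \<le> card {..<3::nat}" by (rule card_mono[OF finite_lessThan])
  then have "\<not> inj_on t {1..4}" using pigeonhole[of t "{1..4}"] by simp
  then obtain p q where pq': "p \<in> {1..4}" "q \<in> {1..4}" "p \<noteq> q" "t p = t q" unfolding inj_on_def by blast
  then have pq: "p \<in> {1..n}" "q \<in> {1..n}" using n by auto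
  have le: "card (S k p \<union> S k q) \<le> card (S k p) + card (S k q)" for k by (rule card_Un_le)
  consider (scarce) k where "card (S k p) \<le> 1" "card (S k q) \<le> 1"
    | (medium) "\<And>k. card (S k p) \<ge> 2" "\<And>k. card (S k q) \<ge> 2"
  proof -
    have "(\<exists>k. card (S k p) \<le> 1 \<and> card (S k q) \<le> 1) \<or> (\<forall>k. card (S k p) \<ge> 2 \<and> card (S k q) \<ge> 2)"
    proof (rule ccontr)
      assume *: "\<not> ?thesis"
      have "2 \<le> m" if "\<not> m \<le> 1" for m :: nat using that by simp
      then obtain l where "card (S l p) \<le> 1 \<or> card (S l q) \<le> 1" using * by blast
      moreover have "\<not> (card (S Red p) \<le> 1 \<and> card (S Red q) \<le> 1)" "\<not> (card (S Blue p) \<le> 1 \<and> card (S Blue q) \<le> 1)"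
        using * by blast+
      ultimately show False
        using pq'(4) unfolding t_def by (cases l) (simp_all split: if_splits)
    qed
    then show thesis using scarce medium by blast
  qed
  then show ?thesis
  proof cases
    case scarce
    obtain X where X: "X \<subseteq> {c \<in> cells n. M c = k}" "card X \<le> 4" "\<forall>A. X \<subseteq> A \<longrightarrow> \<not> two_stars A"
      using proper_kernel[OF _ _ many[of k]] n by fastforce
    \<comment> \<open>At most 1 + 1 + 4 cells, which is where \<open>n \<ge> 6\<close>
      enters.\<close>
    have "card (S k p \<union> S k q \<union> X) \<le> n"
      using card_Un_le[of "S k p \<union> S k q" X] le[of k] scarce X(2) n by linarith
    then show ?thesis using X(3) by (intro extend[OF pq pq'(3) X(1)]) simp_all
  next
    case medium
    \<comment> \<open>The two rows have \<open>2 * n\<close> cells altogether, so one color has at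
      most \<open>n\<close> of them. Its two pairs already exclude two stars, and \<open>X\<close>
      can be empty.\<close>
    have "\<exists>k. card (S k p) + card (S k q) \<le> n"
    proof (cases "card (S Red p) + card (S Red q) \<le> n")
      case False
      then have "card (S Blue p) + card (S Blue q) \<le> n" using sum[OF pq(1)] sum[OF pq(2)] by linarith
      then show ?thesis by blast
    qed blast
    then obtain k where k: "card (S k p) + card (S k q) \<le> n" by blast
    have pair: "\<exists>x y. (i, x) \<in> S k i \<and> (i, y) \<in> S k i \<and> x \<noteq> y" if "card (S k i) \<ge> 2" for i
    proof -
      have "\<not> card (S k i) \<le> Suc 0" using that by simp
      then obtain c d where cd: "c \<in> S k i" "d \<in> S k i" "c \<noteq> d"
        unfolding card_le_Suc0_iff_eq[OF finS] by blast
      then have "c = (i, snd c)" "d = (i, snd d)" unfolding S_def by (auto simp: prod_eq_iff)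
      then show ?thesis using cd by metis
    qed
    obtain x y where xy: "(p, x) \<in> S k p" "(p, y) \<in> S k p" "x \<noteq> y" using pair[OF medium(1)] by blast
    obtain u v where uv: "(q, u) \<in> S k q" "(q, v) \<in> S k q" "u \<noteq> v" using pair[OF medium(2)] by blast
    have "\<not> two_stars A" if "S k p \<union> S k q \<union> {} \<subseteq> A" for A
      using not_two_stars_rows[of p x A y q u v] that pq'(3) xy uv by blast
    moreover have "card (S k p \<union> S k q \<union> {}) \<le> n" using le[of k] k by simp
    ultimately show ?thesis by (intro extend[OF pq pq'(3), of "{}" k]) simp_all
  qed
qed

theorem theorem1:
  fixes n :: nat and M :: "nat \<times> nat \<Rightarrow> color"
  assumes "n \<ge> 7"
  shows "(\<exists>P. partition_on (cells n) P \<and> card P = n \<and> (\<forall>D\<in>P. diagonal n D \<and> balanced M D))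
     \<longleftrightarrow> (\<forall>k. \<exists>A. A \<subseteq> cells n \<and> card A = n \<and> proper n A \<and> (\<forall>c\<in>A. M c = k))"
proof
  assume "\<exists>P. partition_on (cells n) P \<and> card P = n \<and> (\<forall>D\<in>P. diagonal n D \<and> balanced M D)"
  then show "\<forall>k. \<exists>A. A \<subseteq> cells n \<and> card A = n \<and> proper n A \<and> (\<forall>c\<in>A. M c = k)"
    using proper_of_balanced_partition by blast
next
  assume proper: "\<forall>k. \<exists>A. A \<subseteq> cells n \<and> card A = n \<and> proper n A \<and> (\<forall>c\<in>A. M c = k)"
  show "\<exists>P. partition_on (cells n) P \<and> card P = n \<and> (\<forall>D\<in>P. diagonal n D \<and> balanced M D)"
  proof (cases "\<exists>k. card {c \<in> cells n. M c = k} < 2 * n - 1")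
    case True
    then obtain k where k: "card {c \<in> cells n. M c = k} < 2 * n - 1" by blast
    obtain A where A: "A \<subseteq> cells n" "card A = n" "proper n A" "\<forall>c\<in>A. M c = k"
      using proper by blast
    show ?thesis
      by (rule balanced_partition_of_scarce_color[OF _ A(1,2) not_two_stars_if_proper[OF A(1,3)] _ k])
        (use assms A(4) in auto)
  next
    case False
    then have "2 * n - 1 \<le> card {c \<in> cells n. M c = k}" for k by (simp add: not_less)
    moreover have "n \<ge> 6" using assms by simp
    ultimately show ?thesis by (rule balanced_partition_of_abundant_colors[rotated])
  qed
qed

end
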